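(* Let $\mathcal M$ be a von Neumann algebra with closed unit ball $\mathcal M_1$, and let $x\in\mathcal M_1$. The following are equivalent: (i) $x$ is a $C^*$-extreme point of $\mathcal M_1$; (ii) $x$ is a linear extreme point of $\mathcal M_1$; (iii) $x$ is a strongly extreme point of $\mathcal M_1$. In particular, any linear extreme point of the closed unit ball of a unital $C^*$-algebra is a strongly extreme point of that ball.
   Context: For a unital $C^*$-algebra $\mathcal A$ with identity $\mathbf 1$ and closed unit ball $\mathcal A_1$, an element $x\in\mathcal A_1$ is a $C^*$-extreme point of $\mathcal A_1$ if, whenever $x=\sum_{i=1}^k t_i^*x_it_i$ with $x_1,\dots,x_k\in\mathcal A_1$ and $t_1,\dots,t_k\in\mathcal A$ invertible with $\sum_{i=1}^k t_i^*t_i=\mathbf 1$, there exist unitaries $u_1,\dots,u_k\in\mathcal A$ such that $x_i=u_i^*xu_i$ for all $i$. A linear extreme point is an extreme point in the usual sense of convexity. For a Banach space $X$ with closed unit ball $X_1$, a point $x\in X_1$ is a strongly extreme point of $X_1$ if for any sequences $\{x_n\},\{y_n\}$ in $X_1$, $\frac{x_n+y_n}{2}\to x$ in norm implies $x_n-y_n\to 0$ in norm. *)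

theory Defs
  imports "HOL-Analysis.Analysis"
begin

class scaleC =
  fixes scaleC :: "complex \<Rightarrow> 'a \<Rightarrow> 'a"  (infixr \<open>*\<^sub>C\<close> 75)

class complex_vector = real_vector + scaleC +
  assumes scaleC_add_right: "c *\<^sub>C (x + y) = c *\<^sub>C x + c *\<^sub>C y"
    and scaleC_add_left: "(c + d) *\<^sub>C x = c *\<^sub>C x + d *\<^sub>C x"
    and scaleC_scaleC: "c *\<^sub>C (d *\<^sub>C x) = (c * d) *\<^sub>C x"
    and scaleC_of_real: "complex_of_real r *\<^sub>C x = r *\<^sub>R x"

text \<open>The class extends \<open>monoid_mult\<close> rather than \<open>ring_1\<close> or \<open>real_normed_algebra_1\<close>, so that
  the zero algebra (for instance, the operators on the zero Hilbert space) is not excluded.\<close>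

class unital_cstar_algebra = complex_vector + real_normed_algebra + banach + monoid_mult +
  fixes star :: "'a \<Rightarrow> 'a"
  assumes scaleC_mult_left: "(c *\<^sub>C x) * y = c *\<^sub>C (x * y)"
    and scaleC_mult_right: "x * (c *\<^sub>C y) = c *\<^sub>C (x * y)"
    and norm_scaleC: "norm (c *\<^sub>C x) = cmod c * norm x"
    and star_star: "star (star x) = x"
    and star_add: "star (x + y) = star x + star y"
    and star_scaleC: "star (c *\<^sub>C x) = cnj c *\<^sub>C star x"
    and star_mult: "star (x * y) = star y * star x"
    and cstar_identity: "norm (star x * x) = (norm x)\<^sup>2"

text \<open>The complex inner product is linear in its first argument. Its real part is the inner product
  of the class \<open>real_inner\<close>, so \<open>norm\<close> is the Hilbert space norm.\<close>

class chilbert_space = complex_vector + real_inner + banach +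
  fixes cinner :: "'a \<Rightarrow> 'a \<Rightarrow> complex"
  assumes cinner_commute: "cinner x y = cnj (cinner y x)"
    and cinner_add_left: "cinner (x + y) z = cinner x z + cinner y z"
    and cinner_scaleC_left: "cinner (c *\<^sub>C x) y = c * cinner x y"
    and Re_cinner: "Re (cinner x y) = inner x y"

lemma (in chilbert_space) cinner_self: "cinner x x = complex_of_real ((norm x)\<^sup>2)"
proof (rule complex_eqI)
  show "Im (cinner x x) = Im (complex_of_real ((norm x)\<^sup>2))"
    using arg_cong[OF cinner_commute[of x x], of Im] by simp
qed (simp add: Re_cinner power2_norm_eq_inner)

lemma Im_cinner:
  fixes x y :: "'a::chilbert_space"
  shows "Im (cinner x y) = inner ((- \<i>) *\<^sub>C x) y"
  by (simp add: Re_cinner[symmetric] cinner_scaleC_left)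

lemma cinner_scaleC_right:
  fixes x y :: "'a::chilbert_space"
  shows "cinner x (c *\<^sub>C y) = cnj c * cinner x y"
  by (metis cinner_commute cinner_scaleC_left complex_cnj_mult)

lemma cinner_add_right:
  fixes x y z :: "'a::chilbert_space"
  shows "cinner x (y + z) = cinner x y + cinner x z"
  by (metis cinner_add_left cinner_commute complex_cnj_add)

lemma norm_scaleC_hilbert:
  fixes x :: "'a::chilbert_space"
  shows "norm (c *\<^sub>C x) = cmod c * norm x"
proof -
  have "complex_of_real ((norm (c *\<^sub>C x))\<^sup>2) = (c * cnj c) * complex_of_real ((norm x)\<^sup>2)"
    by (simp add: cinner_self[symmetric] cinner_scaleC_left cinner_scaleC_right del: of_real_power)
  also have "\<dots> = complex_of_real ((cmod c * norm x)\<^sup>2)"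
    by (simp add: complex_mult_cnj cmod_def power_mult_distrib)
  finally have "(norm (c *\<^sub>C x))\<^sup>2 = (cmod c * norm x)\<^sup>2"
    using of_real_eq_iff by blast
  thus ?thesis by (simp add: power2_eq_iff_nonneg)
qed

lemma inner_eq_imp_eq:
  fixes y z :: "'a::real_inner"
  assumes "\<And>x. inner x y = inner x z"
  shows "y = z"
proof -
  have "inner (y - z) (y - z) = 0"
    using assms[of "y - z"] by (simp add: inner_diff_right)
  thus ?thesis by simp
qed

lemma riesz_representation:
  fixes f :: "'a::{real_inner, complete_space} \<Rightarrow> real"
  assumes "bounded_linear f"
  shows "\<exists>z. \<forall>x. f x = inner x z"
proof -
  interpret f: bounded_linear f by fact
  define J where "J x = (norm x)\<^sup>2 - 2 * f x" for x
  define m where "m = Inf (range J)"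
  obtain K where K: "\<And>x. \<bar>f x\<bar> \<le> norm x * K"
    using f.bounded by (auto simp: real_norm_def)
  have lower: "- (K\<^sup>2) \<le> J x" for x
  proof -
    have "0 \<le> (norm x - K)\<^sup>2" by simp
    thus ?thesis using K[of x] by (simp add: J_def power2_eq_square algebra_simps)
  qed
  have bdd: "bdd_below (range J)" using lower by (auto intro!: bdd_belowI)
  have m_le: "m \<le> J x" for x
    unfolding m_def by (rule cInf_lower[OF _ bdd]) simp
  have "\<exists>x. J x < m + 1 / real (Suc n)" for n
  proof -
    have "Inf (range J) < m + 1 / real (Suc n)" by (simp add: m_def)
    thus ?thesis by (subst (asm) cInf_less_iff) (use bdd in auto)
  qed
  then obtain X where X: "\<And>n. J (X n) < m + 1 / real (Suc n)" by metis
  have par: "(norm (x - y))\<^sup>2 \<le> 2 * J x + 2 * J y - 4 * m" for x y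
  proof -
    have "J ((1/2) *\<^sub>R (x + y)) = (norm (x + y))\<^sup>2 / 4 - (f x + f y)"
      by (simp only: J_def f.scaleR f.add norm_scaleR power_mult_distrib)
        (simp add: power_divide add_divide_distrib)
    moreover have "(norm (x - y))\<^sup>2 = 2 * (norm x)\<^sup>2 + 2 * (norm y)\<^sup>2 - (norm (x + y))\<^sup>2"
      by (simp add: power2_norm_eq_inner inner_add_left inner_add_right inner_diff_left
          inner_diff_right inner_commute)
    ultimately show ?thesis using m_le[of "(1/2) *\<^sub>R (x + y)"] by (simp add: J_def)
  qed
  have "Cauchy X"
  proof (rule metric_CauchyI)
    fix e :: real assume "0 < e"
    then obtain N where N: "1 / real (Suc N) < e\<^sup>2 / 4"
      using reals_Archimedean[of "e\<^sup>2 / 4"] by (auto simp: inverse_eq_divide)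
    have "dist (X a) (X b) < e" if "a \<ge> N" "b \<ge> N" for a b
    proof -
      have "1 / real (Suc a) \<le> 1 / real (Suc N)" "1 / real (Suc b) \<le> 1 / real (Suc N)"
        using that by (auto intro!: divide_left_mono)
      hence "(norm (X a - X b))\<^sup>2 < e\<^sup>2"
        using par[of "X a" "X b"] X[of a] X[of b] N by linarith
      thus ?thesis using \<open>0 < e\<close> by (simp add: dist_norm power2_less_imp_less)
    qed
    thus "\<exists>N. \<forall>a\<ge>N. \<forall>b\<ge>N. dist (X a) (X b) < e" by blast
  qed
  then obtain z where z: "X \<longlonglongrightarrow> z" using Cauchy_convergent convergentD by blast
  have "(\<lambda>n. J (X n)) \<longlonglongrightarrow> J z"
    unfolding J_def by (intro tendsto_intros f.tendsto z)
  moreover have "(\<lambda>n. m + 1 / real (Suc n)) \<longlonglongrightarrow> m + 0"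
    by (intro tendsto_intros LIMSEQ_Suc[OF lim_1_over_n])
  ultimately have "J z \<le> m + 0"
    by (rule LIMSEQ_le) (use X in \<open>auto intro: less_imp_le\<close>)
  hence Jz: "J z \<le> J x" for x using m_le[of x] by simp
  have "f x = inner x z" for x
  proof -
    define c where "c = inner x z - f x"
    define N where "N = (norm x)\<^sup>2 + 1"
    have N: "N > 0" by (simp add: N_def add_nonneg_pos)
    have "0 \<le> t\<^sup>2 * (norm x)\<^sup>2 + 2 * t * c" for t
    proof -
      have "(norm (z + t *\<^sub>R x))\<^sup>2 = (norm z)\<^sup>2 + 2 * t * inner x z + t\<^sup>2 * (norm x)\<^sup>2"
        unfolding power2_norm_eq_inner
        by (simp add: inner_add_left inner_add_right inner_commute algebra_simps power2_eq_square)
      thus ?thesis using Jz[of "z + t *\<^sub>R x"]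
        by (simp add: J_def c_def f.add f.scaleR algebra_simps)
    qed
    from this[of "- c / N"] have "0 \<le> c\<^sup>2 / N\<^sup>2 * (norm x)\<^sup>2 - 2 * (c\<^sup>2 / N)"
      by (simp add: power_divide power2_eq_square)
    hence "0 \<le> (c\<^sup>2 / N\<^sup>2 * (norm x)\<^sup>2 - 2 * (c\<^sup>2 / N)) * N\<^sup>2" using N by simp
    also have "\<dots> = c\<^sup>2 * (norm x)\<^sup>2 - 2 * c\<^sup>2 * N"
      using N by (simp add: field_simps power2_eq_square)
    also have "\<dots> = - (c\<^sup>2 * (norm x)\<^sup>2) - 2 * c\<^sup>2" by (simp add: N_def algebra_simps)
    finally have "2 * c\<^sup>2 \<le> - (c\<^sup>2 * (norm x)\<^sup>2)" by simp
    moreover have "0 \<le> c\<^sup>2 * (norm x)\<^sup>2" by simp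
    ultimately have "c\<^sup>2 \<le> 0" by linarith
    thus ?thesis by (simp add: c_def)
  qed
  thus ?thesis by blast
qed

lemma scaleC_zero_right [simp]: "c *\<^sub>C (0::'a::complex_vector) = 0"
  using scaleC_add_right[of c "0::'a" 0] by simp

lemma scaleC_minus_right: "c *\<^sub>C (- x) = - (c *\<^sub>C (x::'a::complex_vector))"
  using scaleC_add_right[of c x "- x"] by (simp add: eq_neg_iff_add_eq_0 add.commute)

lemma scaleC_diff_right: "c *\<^sub>C (x - y) = c *\<^sub>C x - c *\<^sub>C (y::'a::complex_vector)"
  using scaleC_add_right[of c x "- y"] by (simp add: scaleC_minus_right)

lemma scaleC_scaleR: "c *\<^sub>C (r *\<^sub>R x) = r *\<^sub>R (c *\<^sub>C (x::'a::complex_vector))"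
  by (simp add: scaleC_of_real[symmetric] scaleC_scaleC mult.commute)

lemma bounded_linear_scaleC: "bounded_linear (\<lambda>x. c *\<^sub>C (x::'a::chilbert_space))"
  by (rule bounded_linear_intro[where K = "cmod c"])
    (simp_all add: scaleC_add_right scaleC_scaleR norm_scaleC_hilbert mult.commute)

typedef (overloaded) 'h cop =
  "{T :: 'h::chilbert_space \<Rightarrow>\<^sub>L 'h. \<forall>c x. blinfun_apply T (c *\<^sub>C x) = c *\<^sub>C blinfun_apply T x}"
  morphisms blinfun_of_cop Abs_cop
  by (rule exI[of _ 0]) simp

setup_lifting type_definition_cop

lift_definition cop_apply :: "'h::chilbert_space cop \<Rightarrow> 'h \<Rightarrow> 'h" is blinfun_apply .

lemma cop_eqI: "(\<And>x. cop_apply S x = cop_apply T x) \<Longrightarrow> S = T"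
  by transfer (rule blinfun_eqI)

lemma cop_apply_scaleC: "cop_apply T (c *\<^sub>C x) = c *\<^sub>C cop_apply T x"
  by transfer simp

lemma bounded_linear_cop_apply: "bounded_linear (cop_apply T)"
  by transfer (rule blinfun.bounded_linear_right)

lemma cop_exists:
  assumes "bounded_linear f" and "\<And>c x. f (c *\<^sub>C x) = c *\<^sub>C f x"
  shows "\<exists>T. cop_apply T = f"
proof -
  have "Blinfun f \<in> {T. \<forall>c x. blinfun_apply T (c *\<^sub>C x) = c *\<^sub>C blinfun_apply T x}"
    using assms by (simp add: bounded_linear_Blinfun_apply)
  hence "cop_apply (Abs_cop (Blinfun f)) = f"
    using assms(1) by (simp add: cop_apply.rep_eq Abs_cop_inverse bounded_linear_Blinfun_apply)
  thus ?thesis by blast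
qed

instantiation cop :: (chilbert_space) real_normed_vector
begin

lift_definition norm_cop :: "'a cop \<Rightarrow> real" is norm .

lift_definition zero_cop :: "'a cop" is 0 by simp

lift_definition plus_cop :: "'a cop \<Rightarrow> 'a cop \<Rightarrow> 'a cop" is "(+)"
  by (simp add: blinfun.add_left scaleC_add_right)

lift_definition minus_cop :: "'a cop \<Rightarrow> 'a cop \<Rightarrow> 'a cop" is "(-)"
  by (simp add: blinfun.diff_left scaleC_diff_right)

lift_definition uminus_cop :: "'a cop \<Rightarrow> 'a cop" is uminus
  by (simp add: blinfun.minus_left scaleC_minus_right)

lift_definition scaleR_cop :: "real \<Rightarrow> 'a cop \<Rightarrow> 'a cop" is scaleR
  by (simp add: blinfun.scaleR_left scaleC_scaleR)

definition dist_cop :: "'a cop \<Rightarrow> 'a cop \<Rightarrow> real"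
  where "dist_cop S T = norm (S - T)"

definition uniformity_cop :: "('a cop \<times> 'a cop) filter"
  where "uniformity_cop = (INF e\<in>{0<..}. principal {(S, T). dist S T < e})"

definition open_cop :: "'a cop set \<Rightarrow> bool"
  where "open_cop U = (\<forall>S\<in>U. \<forall>\<^sub>F (S', T) in uniformity. S' = S \<longrightarrow> T \<in> U)"

definition sgn_cop :: "'a cop \<Rightarrow> 'a cop"
  where "sgn_cop T = inverse (norm T) *\<^sub>R T"

instance
  apply standard
  unfolding dist_cop_def open_cop_def sgn_cop_def uniformity_cop_def
  by (rule refl | (transfer, simp add: algebra_simps norm_triangle_ineq))+

end

lemma blinfun_apply_scaleC:
  "blinfun_apply (Blinfun (\<lambda>x. c *\<^sub>C blinfun_apply T x)) x = c *\<^sub>C blinfun_apply T x"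
  for T :: "'h::real_normed_vector \<Rightarrow>\<^sub>L 'k::chilbert_space"
  by (subst bounded_linear_Blinfun_apply)
    (rule bounded_linear_compose[OF bounded_linear_scaleC blinfun.bounded_linear_right], rule refl)

instantiation cop :: (chilbert_space) complex_vector
begin

lift_definition scaleC_cop :: "complex \<Rightarrow> 'a cop \<Rightarrow> 'a cop"
  is "\<lambda>c T. Blinfun (\<lambda>x. c *\<^sub>C blinfun_apply T x)"
  by (simp add: blinfun_apply_scaleC scaleC_scaleC mult.commute)

lemma cop_apply_simps:
  "cop_apply 0 x = 0"
  "cop_apply (S + T) x = cop_apply S x + cop_apply T x"
  "cop_apply (S - T) x = cop_apply S x - cop_apply T x"
  "cop_apply (- T) x = - cop_apply T x"
  "cop_apply (r *\<^sub>R T) x = r *\<^sub>R cop_apply T x"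
  "cop_apply (c *\<^sub>C T) x = c *\<^sub>C cop_apply T x"
  by (transfer, simp add: blinfun.bilinear_simps blinfun_apply_scaleC)+

instance
  by standard (rule cop_eqI, simp add: cop_apply_simps scaleC_add_right scaleC_add_left
      scaleC_scaleC scaleC_of_real)+

end

lemma norm_cop_apply: "norm (cop_apply T x) \<le> norm T * norm x"
  by transfer (rule norm_blinfun)

lemma norm_cop_bound:
  "0 \<le> b \<Longrightarrow> (\<And>x. norm (cop_apply T x) \<le> b * norm x) \<Longrightarrow> norm T \<le> b"
  by transfer (rule norm_blinfun_bound)

lemma norm_cop_onorm: "norm T = onorm (cop_apply T)"
  by transfer (simp add: norm_blinfun.rep_eq)

instance cop :: (chilbert_space) banach
proof
  fix X :: "nat \<Rightarrow> 'a cop"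
  assume X: "Cauchy X"
  have dist_eq: "dist (blinfun_of_cop S) (blinfun_of_cop T) = dist S T" for S T :: "'a cop"
    by (simp only: dist_norm norm_cop.rep_eq minus_cop.rep_eq)
  have "Cauchy (\<lambda>n. blinfun_of_cop (X n))"
    using X by (simp add: Cauchy_def dist_eq)
  then obtain B where B: "(\<lambda>n. blinfun_of_cop (X n)) \<longlonglongrightarrow> B"
    using Cauchy_convergent convergentD by blast
  have "blinfun_apply B (c *\<^sub>C x) = c *\<^sub>C blinfun_apply B x" for c x
  proof (rule LIMSEQ_unique)
    show "(\<lambda>n. blinfun_apply (blinfun_of_cop (X n)) (c *\<^sub>C x)) \<longlonglongrightarrow> blinfun_apply B (c *\<^sub>C x)"
      by (intro tendsto_intros B)
    have "(\<lambda>n. c *\<^sub>C blinfun_apply (blinfun_of_cop (X n)) x) \<longlonglongrightarrow> c *\<^sub>C blinfun_apply B x"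
      by (intro bounded_linear.tendsto[OF bounded_linear_scaleC] tendsto_intros B)
    thus "(\<lambda>n. blinfun_apply (blinfun_of_cop (X n)) (c *\<^sub>C x)) \<longlonglongrightarrow> c *\<^sub>C blinfun_apply B x"
      by (simp add: cop_apply_scaleC flip: cop_apply.rep_eq)
  qed
  hence "B = blinfun_of_cop (Abs_cop B)" by (simp add: Abs_cop_inverse)
  then obtain T where T: "B = blinfun_of_cop T" ..
  have "X \<longlonglongrightarrow> T"
    using B unfolding T by (subst (asm) tendsto_dist_iff, subst tendsto_dist_iff)
      (simp only: dist_eq)
  thus "convergent X" by (rule convergentI)
qed

text \<open>Such an \<open>S\<close> exists by the Riesz representation theorem (\<open>cadjoint_exists\<close>) and is unique
  by \<open>cop_eqI_cinner\<close>.\<close>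

definition cadjoint :: "'h::chilbert_space cop \<Rightarrow> 'h cop" where
  "cadjoint T = (SOME S. \<forall>x y. cinner (cop_apply T x) y = cinner x (cop_apply S y))"

lemma cadjoint_exists:
  fixes T :: "'h::chilbert_space cop"
  shows "\<exists>S. \<forall>x y. cinner (cop_apply T x) y = cinner x (cop_apply S y)"
proof -
  have "\<exists>z. \<forall>x. inner (cop_apply T x) y = inner x z" for y
    by (rule riesz_representation)
      (rule bounded_linear_compose[OF bounded_linear_inner_left bounded_linear_cop_apply])
  then obtain g where g: "\<And>x y. inner (cop_apply T x) y = inner x (g y)" by metis
  have cg: "cinner (cop_apply T x) y = cinner x (g y)" for x y
    by (rule complex_eqI) (simp_all add: Re_cinner Im_cinner g flip: cop_apply_scaleC)
  have eqI: "y = z" if "\<And>x. cinner x y = cinner x z" for y z :: 'h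
    by (rule inner_eq_imp_eq) (simp add: Re_cinner[symmetric] that)
  have gadd: "g (y + z) = g y + g z" for y z
    by (rule eqI) (simp add: cinner_add_right flip: cg)
  have gscale: "g (c *\<^sub>C y) = c *\<^sub>C g y" for c y
    by (rule eqI) (simp add: cinner_scaleC_right flip: cg)
  have "norm (g y) \<le> norm y * norm T" for y
  proof (cases "g y = 0")
    case False
    have "(norm (g y))\<^sup>2 = inner (cop_apply T (g y)) y"
      by (simp add: g power2_norm_eq_inner)
    also have "\<dots> \<le> norm (cop_apply T (g y)) * norm y" by (rule norm_cauchy_schwarz)
    also have "\<dots> \<le> (norm T * norm (g y)) * norm y"
      by (intro mult_right_mono norm_cop_apply) simp
    finally show ?thesis using False by (simp add: power2_eq_square mult_ac)
  qed simp
  moreover have "g (r *\<^sub>R y) = r *\<^sub>R g y" for r y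
    using gscale[of "complex_of_real r" y] by (simp add: scaleC_of_real)
  ultimately have "bounded_linear g"
    by (intro bounded_linear_intro[where K = "norm T"] gadd)
  then obtain S where "cop_apply S = g" using cop_exists gscale by blast
  thus ?thesis using cg by blast
qed

lemma cinner_cadjoint: "cinner (cop_apply T x) y = cinner x (cop_apply (cadjoint T) y)"
  using someI_ex[OF cadjoint_exists[of T]] unfolding cadjoint_def by blast

lemma cinner_cadjoint': "cinner (cop_apply (cadjoint T) x) y = cinner x (cop_apply T y)"
  by (metis cinner_cadjoint cinner_commute)

lemma cop_eqI_cinner:
  assumes "\<And>x y. cinner x (cop_apply S y) = cinner x (cop_apply T y)"
  shows "S = T"
  by (rule cop_eqI, rule inner_eq_imp_eq) (simp add: Re_cinner[symmetric] assms)

lemma norm_cop_sq_le: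
  fixes T :: "'h::chilbert_space cop"
  assumes S: "\<And>x. cop_apply S x = cop_apply (cadjoint T) (cop_apply T x)"
  shows "(norm T)\<^sup>2 \<le> norm S"
proof -
  have "norm (cop_apply T x) \<le> sqrt (norm S) * norm x" for x
  proof -
    have "(norm (cop_apply T x))\<^sup>2 = inner x (cop_apply S x)"
      by (simp add: power2_norm_eq_inner S flip: Re_cinner cinner_cadjoint)
    also have "\<dots> \<le> norm x * norm (cop_apply S x)" by (rule norm_cauchy_schwarz)
    also have "\<dots> \<le> norm x * (norm S * norm x)"
      by (intro mult_left_mono norm_cop_apply) simp
    also have "\<dots> = (sqrt (norm S) * norm x)\<^sup>2"
      by (simp add: power_mult_distrib power2_eq_square)
    finally show ?thesis by (rule power2_le_imp_le) simp
  qed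
  hence "norm T \<le> sqrt (norm S)" by (intro norm_cop_bound) simp_all
  hence "(norm T)\<^sup>2 \<le> (sqrt (norm S))\<^sup>2" by (intro power_mono) simp_all
  thus ?thesis by simp
qed

instantiation cop :: (chilbert_space) unital_cstar_algebra
begin

lift_definition one_cop :: "'a cop" is id_blinfun by simp

lift_definition times_cop :: "'a cop \<Rightarrow> 'a cop \<Rightarrow> 'a cop" is blinfun_compose by simp

definition star_cop :: "'a cop \<Rightarrow> 'a cop" where "star_cop = cadjoint"

instance
proof
  have app: "cop_apply (S * T) x = cop_apply S (cop_apply T x)" "cop_apply 1 x = x"
    for S T :: "'a cop" and x
    by (transfer, simp)+
  have lin: "cop_apply S (x + y) = cop_apply S x + cop_apply S y"
    "cop_apply S (r *\<^sub>R x) = r *\<^sub>R cop_apply S x" for S :: "'a cop" and x y r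
    using bounded_linear_cop_apply[of S]
    by (simp_all add: linear_simps)
  fix R S T :: "'a cop" and c :: complex and r :: real
  note simps = app lin cop_apply_simps cop_apply_scaleC
  show "(R * S) * T = R * (S * T)" "1 * T = T" "T * 1 = T"
    "(R + S) * T = R * T + S * T" "R * (S + T) = R * S + R * T"
    "(r *\<^sub>R S) * T = r *\<^sub>R (S * T)" "S * (r *\<^sub>R T) = r *\<^sub>R (S * T)"
    "(c *\<^sub>C S) * T = c *\<^sub>C (S * T)" "S * (c *\<^sub>C T) = c *\<^sub>C (S * T)"
    by (rule cop_eqI; simp add: simps)+
  show mult: "norm (S * T) \<le> norm S * norm T" for S T :: "'a cop"
    by transfer (rule norm_blinfun_compose)
  show "star (star T) = T" "star (S + T) = star S + star T"
    "star (c *\<^sub>C T) = cnj c *\<^sub>C star T" "star (S * T) = star T * star S"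
    unfolding star_cop_def
    by (rule cop_eqI_cinner;
        simp add: simps cinner_cadjoint' cinner_add_right cinner_add_left cinner_scaleC_right
          cinner_scaleC_left flip: cinner_cadjoint)+
  show "norm (c *\<^sub>C T) = cmod c * norm T"
  proof (rule antisym)
    show le: "norm (c *\<^sub>C T) \<le> cmod c * norm T" for c and T :: "'a cop"
      by (rule norm_cop_bound)
        (simp_all add: cop_apply_simps norm_scaleC_hilbert mult.assoc mult_left_mono norm_cop_apply)
    show "cmod c * norm T \<le> norm (c *\<^sub>C T)"
    proof (cases "c = 0")
      case False
      have "inverse c *\<^sub>C (c *\<^sub>C T) = T"
        using False scaleC_of_real[of 1 T] by (simp add: scaleC_scaleC)
      hence "norm T \<le> cmod (inverse c) * norm (c *\<^sub>C T)"
        using le[of "inverse c" "c *\<^sub>C T"] by simp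
      hence "cmod c * norm T \<le> cmod c * (cmod (inverse c) * norm (c *\<^sub>C T))"
        by (rule mult_left_mono) simp
      also have "\<dots> = norm (c *\<^sub>C T)"
        using False by (simp add: mult.assoc[symmetric] norm_mult[symmetric])
      finally show ?thesis .
    qed simp
  qed
  have sq: "(norm T)\<^sup>2 \<le> norm (star T * T)" for T :: "'a cop"
    by (rule norm_cop_sq_le) (simp add: app star_cop_def)
  have star_le: "norm T \<le> norm (star T)" for T :: "'a cop"
  proof (cases "T = 0")
    case False
    have "norm T * norm T \<le> norm (star T) * norm T"
      using sq[of T] mult[of "star T" T] by (simp add: power2_eq_square)
    thus ?thesis using False by simp
  qed simp
  have "norm (star T) \<le> norm T"
    using star_le[of "star T"] \<open>star (star T) = T\<close> by simp
  hence "norm (star T) * norm T \<le> (norm T)\<^sup>2"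
    by (simp add: power2_eq_square mult_right_mono)
  thus "norm (star T * T) = (norm T)\<^sup>2"
    using sq[of T] mult[of "star T" T] by linarith
qed

end

lemma cop_apply_times: "cop_apply (S * T) x = cop_apply S (cop_apply T x)"
  by transfer simp

lemma cop_apply_one: "cop_apply 1 x = x"
  by transfer simp

lemma cinner_star: "cinner (cop_apply T x) y = cinner x (cop_apply (star T) y)"
  by (simp add: star_cop_def cinner_cadjoint)

definition unital_star_subalgebra :: "'a::unital_cstar_algebra set \<Rightarrow> bool" where
  "unital_star_subalgebra A \<longleftrightarrow>
     1 \<in> A \<and> (\<forall>a\<in>A. \<forall>b\<in>A. a + b \<in> A \<and> a * b \<in> A) \<and>
     (\<forall>c. \<forall>a\<in>A. c *\<^sub>C a \<in> A) \<and> (\<forall>a\<in>A. star a \<in> A)"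

definition commutant :: "'h::chilbert_space cop set \<Rightarrow> 'h cop set" where
  "commutant M = {T. \<forall>S\<in>M. T * S = S * T}"

text \<open>This is the definition of Dixmier and Takesaki. Closedness in the operator topologies is a
  consequence.\<close>

definition von_neumann_algebra :: "'h::chilbert_space cop set \<Rightarrow> bool" where
  "von_neumann_algebra M \<longleftrightarrow> unital_star_subalgebra M \<and> commutant (commutant M) = M"

text \<open>Invertibility, unitarity and the unit ball are taken relative to a carrier \<open>A\<close>, meant to be a
  norm-closed unital *-subalgebra.\<close>

definition unit_ball :: "'a::real_normed_vector set \<Rightarrow> 'a set" where
  "unit_ball A = {a \<in> A. norm a \<le> 1}"

definition invertible_in :: "'a::unital_cstar_algebra set \<Rightarrow> 'a \<Rightarrow> bool" where
  "invertible_in A t \<longleftrightarrow> t \<in> A \<and> (\<exists>s\<in>A. s * t = 1 \<and> t * s = 1)"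

definition unitary_in :: "'a::unital_cstar_algebra set \<Rightarrow> 'a \<Rightarrow> bool" where
  "unitary_in A u \<longleftrightarrow> u \<in> A \<and> star u * u = 1 \<and> u * star u = 1"

definition cstar_extreme_point_of_ball :: "'a::unital_cstar_algebra \<Rightarrow> 'a set \<Rightarrow> bool" where
  "cstar_extreme_point_of_ball x A \<longleftrightarrow>
     x \<in> unit_ball A \<and>
     (\<forall>(k::nat) y t.
        (\<forall>i\<in>{1..k}. y i \<in> unit_ball A \<and> invertible_in A (t i)) \<and>
        (\<Sum>i = 1..k. star (t i) * t i) = 1 \<and>
        x = (\<Sum>i = 1..k. star (t i) * y i * t i) \<longrightarrow>
        (\<exists>u. \<forall>i\<in>{1..k}. unitary_in A (u i) \<and> y i = star (u i) * x * u i))"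

definition strongly_extreme_point_of :: "'a::real_normed_vector \<Rightarrow> 'a set \<Rightarrow> bool"
    (infixr \<open>strongly'_extreme'_point'_of\<close> 50) where
  "x strongly_extreme_point_of S \<longleftrightarrow>
     x \<in> S \<and>
     (\<forall>X Y :: nat \<Rightarrow> 'a.
        (\<forall>n. X n \<in> S \<and> Y n \<in> S) \<and> (\<lambda>n. (1/2) *\<^sub>R (X n + Y n)) \<longlonglongrightarrow> x \<longrightarrow>
        (\<lambda>n. X n - Y n) \<longlonglongrightarrow> 0)"

end

theory Submission
  imports Defs
begin

text \<open>Kadison's description of extreme points links everything: \<open>x\<close> is extreme in the ball of \<open>A\<close> iff
  \<open>x\<close> is a partial isometry with \<open>(1 - x x\<^sup>*) A (1 - x\<^sup>* x) = 0\<close>. Given such an \<open>x\<close> and \<open>m = (a + b)/2\<close>,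
  \<open>z = (a - b)/2\<close>, the inequality \<open>z\<^sup>* z \<le> 1 - m\<^sup>* m\<close> and its adjoint version make \<open>z x\<^sup>* x\<close> and
  \<open>x x\<^sup>* z\<close> small when \<open>m\<close> is near \<open>x\<close>, while the remaining corner of \<open>z\<close> is zero.

  If \<open>x = v k\<close> (polar decomposition) is \<open>C\<^sup>*\<close>-extreme, writing \<open>k\<close> as the average of a unitary \<open>u\<close> and its
  adjoint makes \<open>x\<close> unitarily equivalent to the partial isometry \<open>v u\<close>; and every contraction \<open>b\<close> in
  the corner makes \<open>x + b\<close> a partial isometry, so \<open>b\<^sup>* b\<close> is idempotent, likewise for \<open>b/2\<close>, whence \<open>b = 0\<close>.

  Conversely a central projection reduces to an isometry \<open>x\<close>. A \<open>C\<^sup>*\<close>-convex combination of \<open>y\<^sub>i\<close> giving \<open>x\<close>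
  forces \<open>y\<^sub>i t\<^sub>i = t\<^sub>i x\<close> with \<open>y\<^sub>i\<close> isometric; matching the Wold decompositions of \<open>x\<close> and \<open>y\<^sub>i\<close> turns this
  similarity into a unitary equivalence.\<close>

section \<open>Positivity in unital C*-algebras\<close>

lemma star_zero [simp]: "star (0::'a::unital_cstar_algebra) = 0"
  using star_add[of "0::'a" 0] by simp

lemma star_minus: "star (- x) = - star (x::'a::unital_cstar_algebra)"
  using star_add[of x "- x"] by (simp add: eq_neg_iff_add_eq_0 add.commute)

lemma star_diff: "star (x - y) = star x - star (y::'a::unital_cstar_algebra)"
  using star_add[of x "- y"] by (simp add: star_minus)

lemma star_scaleR: "star (r *\<^sub>R x) = r *\<^sub>R star (x::'a::unital_cstar_algebra)"
  using star_scaleC[of "complex_of_real r" x] by (simp add: scaleC_of_real)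

lemma star_one [simp]: "star (1::'a::unital_cstar_algebra) = 1"
  using star_mult[of 1 "star (1::'a)"] by (simp add: star_star)

lemma star_sum: "star (sum f I) = (\<Sum>i\<in>I. star (f i :: 'a::unital_cstar_algebra))"
  by (induction I rule: infinite_finite_induct) (simp_all add: star_add)

lemma star_power: "star (x ^ n) = star (x::'a::unital_cstar_algebra) ^ n"
  by (induction n) (simp_all add: star_mult power_commutes)

lemmas star_simps = star_add star_diff star_minus star_scaleR star_mult star_star

lemma norm_star [simp]: "norm (star x) = norm (x::'a::unital_cstar_algebra)"
proof -
  have le: "norm y \<le> norm (star y)" for y :: 'a
  proof (cases "y = 0")
    case False
    have "norm y * norm y \<le> norm (star y) * norm y"
      using cstar_identity[of y] norm_mult_ineq[of "star y" y] by (simp add: power2_eq_square)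
    thus ?thesis using False by simp
  qed simp
  show ?thesis using le[of x] le[of "star x"] by (simp add: star_star)
qed

lemma cstar_identity': "norm (x * star x) = (norm (x::'a::unital_cstar_algebra))\<^sup>2"
  using cstar_identity[of "star x"] by (simp add: star_star)

lemma star_mult_self_eq_0: "star x * x = 0 \<longleftrightarrow> (x::'a::unital_cstar_algebra) = 0"
  using cstar_identity[of x] by auto

lemma norm_sq_selfadjoint:
  "star x = x \<Longrightarrow> norm (x * x) = (norm (x::'a::unital_cstar_algebra))\<^sup>2"
  using cstar_identity[of x] by simp

text \<open>Equality fails in the zero algebra, which the class admits. The C*-identity makes the
  norm of 1 equal to its own square.\<close>

lemma norm_one_le: "norm (1::'a::unital_cstar_algebra) \<le> 1"
proof -
  have "norm (1::'a) = (norm (1::'a))\<^sup>2" using cstar_identity[of "1::'a"] by simp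
  thus ?thesis by (auto simp: power2_eq_square)
qed

lemma norm_scaleR_one_le: "0 \<le> c \<Longrightarrow> norm (c *\<^sub>R (1::'a::unital_cstar_algebra)) \<le> c"
  using mult_left_mono[OF norm_one_le, of c] by simp

lemma bounded_linear_star: "bounded_linear (star :: 'a::unital_cstar_algebra \<Rightarrow> 'a)"
  by (rule bounded_linear_intro[where K = 1]) (simp_all add: star_simps)

lemma scaleC_minus_left: "(- c) *\<^sub>C x = - (c *\<^sub>C (x::'a::complex_vector))"
  using scaleC_add_left[of c "- c" x] scaleC_of_real[of 0 x]
  by (simp add: eq_neg_iff_add_eq_0 add.commute)

lemma scaleC_minus_one: "(- 1) *\<^sub>C x = - (x::'a::complex_vector)"
  using scaleC_of_real[of "- 1" x] by simp

text \<open>Stands in for 0 <= a^2 <= a^2 + b^2 before any order is available. Commutation gives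
  \<open>star c * c = a * a + b * b\<close> for \<open>c = a + \<i> *\<^sub>C b\<close>, and
  \<open>a\<close>, the real part of \<open>c\<close>, has norm at most that of
  \<open>c\<close>.\<close>

lemma norm_sq_le_sum_squares:
  fixes a b :: "'a::unital_cstar_algebra"
  assumes a: "star a = a" and b: "star b = b" and ab: "a * b = b * a"
  shows "(norm a)\<^sup>2 \<le> norm (a * a + b * b)"
proof -
  define c where "c = a + \<i> *\<^sub>C b"
  have sc: "star c = a + (- \<i>) *\<^sub>C b"
    by (simp add: c_def star_add star_scaleC a b)
  have "star c * c = a * a + b * b"
    unfolding sc scaleC_minus_left by (simp add: c_def algebra_simps scaleC_mult_left scaleC_mult_right
        scaleC_scaleC scaleC_diff_right scaleC_minus_one ab)
  hence nc: "(norm c)\<^sup>2 = norm (a * a + b * b)" using cstar_identity[of c] by simp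
  have "2 *\<^sub>R a = c + star c" unfolding sc scaleC_minus_left by (simp add: scaleR_2 c_def)
  hence "2 * norm a \<le> norm c + norm (star c)"
    by (metis norm_triangle_ineq norm_scaleR abs_numeral)
  hence "norm a \<le> norm c" by simp
  thus ?thesis by (simp flip: nc add: power_mono)
qed

text \<open>The root is \<open>1 - z\<close> with \<open>z = (t + z\<^sup>2)/2\<close>; the iteration for \<open>z\<close> is dominated, increments included, by
  the scalar iteration with \<open>t = 1\<close>, which also covers the boundary case \<open>\<parallel>t\<parallel> = 1\<close>.\<close>

lemma sqrt_one_minus:
  fixes t :: "'a::unital_cstar_algebra"
  assumes st: "star t = t" and nt: "norm t \<le> 1"
  obtains r where "star r = r" "norm (1 - r) \<le> 1" "r * r = 1 - t"
    "\<And>w. w * t = t * w \<Longrightarrow> w * r = r * w"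
proof -
  define y where "y = rec_nat 0 (\<lambda>_ v. (1/2) *\<^sub>R (t + v * v))"
  define h where "h = rec_nat 0 (\<lambda>_ v. (1/2) * (1 + v * v :: real))"
  have y: "y 0 = 0" "\<And>n. y (Suc n) = (1/2) *\<^sub>R (t + y n * y n)" by (simp_all add: y_def)
  have h: "h 0 = 0" "\<And>n. h (Suc n) = (1/2) * (1 + h n * h n)" by (simp_all add: h_def)
  have h01: "0 \<le> h n \<and> h n \<le> 1" for n
    by (induction n) (auto simp: h intro: mult_le_one)
  have yh: "norm (y n) \<le> h n" for n
  proof (induction n)
    case (Suc n)
    have "norm (y (Suc n)) \<le> (1/2) * (norm t + norm (y n * y n))"
      using norm_triangle_ineq[of t "y n * y n"] by (simp add: y)
    also have "norm (y n * y n) \<le> h n * h n"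
      using norm_mult_ineq[of "y n" "y n"] mult_mono[OF Suc Suc] h01[of n] by simp
    finally show ?case using nt by (simp add: h)
  qed (simp add: y h)
  have step: "norm (y (Suc n) - y n) \<le> h (Suc n) - h n" for n
  proof (induction n)
    case (Suc n)
    \<comment> \<open>Splitting b^2 - a^2 as b(b - a) + (b - a)a needs no commutativity, and each
      factor is bounded by its scalar counterpart.\<close>
    have "y (Suc (Suc n)) - y (Suc n)
        = (1/2) *\<^sub>R (y (Suc n) * (y (Suc n) - y n) + (y (Suc n) - y n) * y n)"
      unfolding y(2)[of "Suc n"] by (subst (3) y(2)) (simp add: algebra_simps)
    hence "norm (y (Suc (Suc n)) - y (Suc n))
        \<le> (1/2) * (norm (y (Suc n)) * norm (y (Suc n) - y n) + norm (y (Suc n) - y n) * norm (y n))"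
      using norm_triangle_ineq[of "y (Suc n) * (y (Suc n) - y n)" "(y (Suc n) - y n) * y n"]
        norm_mult_ineq[of "y (Suc n)" "y (Suc n) - y n"] norm_mult_ineq[of "y (Suc n) - y n" "y n"]
      by simp
    also have "\<dots> \<le> (1/2) * (h (Suc n) * (h (Suc n) - h n) + (h (Suc n) - h n) * h n)"
      using Suc yh h01 order_trans[OF norm_ge_zero Suc] by (intro mult_left_mono add_mono mult_mono) (auto intro: order_trans[OF norm_ge_zero])
    also have "\<dots> = h (Suc (Suc n)) - h (Suc n)"
      using h(2)[of n] unfolding h(2)[of "Suc n"] by (simp add: algebra_simps)
    finally show ?case .
  qed (simp add: y h nt)
  have "h n \<le> h (Suc n)" for n
    using order_trans[OF norm_ge_zero step[of n]] by simp
  hence hmono: "incseq h" by (rule incseq_SucI)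
  have tele: "norm (y (n + k) - y n) \<le> h (n + k) - h n" for n k
  proof (induction k)
    case (Suc k)
    thus ?case using step[of "n + k"] norm_triangle_ineq[of "y (n + Suc k) - y (n + k)" "y (n + k) - y n"]
      by simp
  qed simp
  have "Bseq h" by (rule BseqI'[of _ 1]) (use h01 in auto)
  hence "Cauchy h" using hmono by (intro convergent_Cauchy Bseq_mono_convergent) (auto dest: incseqD)
  have "Cauchy y"
  proof (rule metric_CauchyI)
    fix e :: real assume "0 < e"
    then obtain N where N: "\<And>m n. m \<ge> N \<Longrightarrow> n \<ge> N \<Longrightarrow> dist (h m) (h n) < e"
      using \<open>Cauchy h\<close> by (meson metric_CauchyD)
    have *: "dist (y m) (y n) < e" if "m \<ge> N" "n \<ge> N" "n \<le> m" for m n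
      using tele[of n "m - n"] N[OF that(1,2)] that by (simp add: dist_norm)
    have "dist (y m) (y n) < e" if "m \<ge> N" "n \<ge> N" for m n
      using *[of m n] *[of n m] that by (cases "n \<le> m") (auto simp: dist_commute)
    thus "\<exists>N. \<forall>m\<ge>N. \<forall>n\<ge>N. dist (y m) (y n) < e" by blast
  qed
  then obtain z where z: "y \<longlonglongrightarrow> z" using Cauchy_convergent convergentD by blast
  have "(\<lambda>n. y (Suc n)) \<longlonglongrightarrow> (1/2) *\<^sub>R (t + z * z)"
    unfolding y by (intro tendsto_intros z)
  hence zz: "z = (1/2) *\<^sub>R (t + z * z)"
    using LIMSEQ_unique LIMSEQ_Suc[OF z] by blast
  have "star (y n) = y n" for n by (induction n) (simp_all add: y star_simps st)
  moreover have "(\<lambda>n. star (y n)) \<longlonglongrightarrow> star z"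
    by (rule bounded_linear.tendsto[OF bounded_linear_star z])
  ultimately have sz: "star z = z" using z LIMSEQ_unique by (metis (no_types, lifting) ext)
  have nz: "norm z \<le> 1"
    by (rule LIMSEQ_le_const2[OF tendsto_norm[OF z]]) (use yh h01 order_trans in blast)
  \<comment> \<open>Each iterate is a polynomial in \<open>t\<close>, so commutation with
    \<open>t\<close> survives in the limit. This clause later places square roots in the
    bicommutant.\<close>
  have cz: "w * z = z * w" if "w * t = t * w" for w
  proof -
    have "w * y n = y n * w" for n
    proof (induction n)
      case (Suc n)
      have "w * (y n * y n) = y n * y n * w" by (metis Suc mult.assoc)
      thus ?case by (simp add: y algebra_simps that)
    qed (simp add: y)
    moreover have "(\<lambda>n. w * y n) \<longlonglongrightarrow> w * z" "(\<lambda>n. y n * w) \<longlonglongrightarrow> z * w"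
      by (intro tendsto_intros z)+
    ultimately show ?thesis using LIMSEQ_unique by auto
  qed
  show ?thesis
  proof (rule that[of "1 - z"])
    have "2 *\<^sub>R z = t + z * z" by (subst zz) simp
    thus "(1 - z) * (1 - z) = 1 - t" by (simp add: algebra_simps scaleR_2)
  qed (simp_all add: star_simps sz nz cz algebra_simps)
qed

text \<open>This norm condition is equivalent to having spectrum in \<open>[0, \<infinity>)\<close>; it makes closure under
  sums immediate and needs no spectral theory.\<close>

definition pos :: "'a::unital_cstar_algebra \<Rightarrow> bool" where
  "pos a \<longleftrightarrow> star a = a \<and> (\<exists>c\<ge>0. norm (c *\<^sub>R 1 - a) \<le> c)"

lemma pos_selfadjoint: "pos a \<Longrightarrow> star a = a"
  by (simp add: pos_def)

lemma pos_zero [simp]: "pos 0"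
  by (auto simp: pos_def intro!: exI[of _ 0])

lemma pos_one [simp]: "pos 1"
  by (auto simp: pos_def intro!: exI[of _ 1])

lemma pos_add:
  assumes "pos a" "pos b" shows "pos (a + b)"
proof -
  obtain c d where "c \<ge> 0" "norm (c *\<^sub>R 1 - a) \<le> c" "d \<ge> 0" "norm (d *\<^sub>R 1 - b) \<le> d"
    using assms unfolding pos_def by blast
  moreover have "norm ((c + d) *\<^sub>R 1 - (a + b))
      \<le> norm (c *\<^sub>R 1 - a) + norm (d *\<^sub>R 1 - b)"
    by (simp add: scaleR_left_distrib norm_diff_triangle_ineq)
  ultimately have "norm ((c + d) *\<^sub>R 1 - (a + b)) \<le> c + d" by linarith
  thus ?thesis using assms \<open>c \<ge> 0\<close> \<open>d \<ge> 0\<close>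
    unfolding pos_def by (auto simp: star_add intro!: exI[of _ "c + d"])
qed

lemma pos_scaleR:
  assumes "pos a" "0 \<le> r" shows "pos (r *\<^sub>R a)"
proof -
  obtain c where c: "c \<ge> 0" "norm (c *\<^sub>R 1 - a) \<le> c"
    using assms unfolding pos_def by blast
  have "(r * c) *\<^sub>R 1 - r *\<^sub>R a = r *\<^sub>R (c *\<^sub>R 1 - a)" by (simp add: algebra_simps)
  hence "norm ((r * c) *\<^sub>R 1 - r *\<^sub>R a) \<le> r * c" using c assms by (simp add: mult_left_mono)
  thus ?thesis using assms c unfolding pos_def
    by (auto simp: star_scaleR intro!: exI[of _ "r * c"])
qed

lemma pos_sum: "(\<And>i. i \<in> I \<Longrightarrow> pos (f i)) \<Longrightarrow> pos (sum f I)"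
  by (induction I rule: infinite_finite_induct) (simp_all add: pos_add)

text \<open>Rescaling by the constant \<open>c\<close> from \<open>pos\<close> turns
  \<open>a\<close> into \<open>1 - t\<close> with \<open>t\<close> of norm at most 1. For c = 0 one
  cannot divide, but then a = 0.\<close>

lemma pos_sqrt:
  assumes "pos a"
  obtains r where "pos r" "r * r = a" "\<And>w. w * a = a * w \<Longrightarrow> w * r = r * w"
proof -
  obtain c where c: "c \<ge> 0" "norm (c *\<^sub>R 1 - a) \<le> c" and sa: "star a = a"
    using assms unfolding pos_def by blast
  show ?thesis
  proof (cases "c = 0")
    case True
    thus ?thesis using c that[of 0] by simp
  next
    case False
    hence cp: "c > 0" using c by simp
    define t where "t = 1 - (1/c) *\<^sub>R a"
    have "t = (1/c) *\<^sub>R (c *\<^sub>R 1 - a)" using cp by (simp add: t_def algebra_simps)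
    hence "norm t \<le> 1" using c cp by (simp add: divide_le_eq)
    moreover have "star t = t" by (simp add: t_def star_simps sa)
    ultimately obtain r where r: "star r = r" "norm (1 - r) \<le> 1" "r * r = 1 - t"
      and com: "\<And>w. w * t = t * w \<Longrightarrow> w * r = r * w"
      using sqrt_one_minus by metis
    show ?thesis
    proof (rule that[of "sqrt c *\<^sub>R r"])
      show "pos (sqrt c *\<^sub>R r)"
        by (rule pos_scaleR) (use r cp in \<open>auto simp: pos_def intro!: exI[of _ 1]\<close>)
      show "(sqrt c *\<^sub>R r) * (sqrt c *\<^sub>R r) = a"
        using cp by (simp add: r t_def)
      show "w * (sqrt c *\<^sub>R r) = (sqrt c *\<^sub>R r) * w" if "w * a = a * w" for w
        using com[of w] that by (simp add: t_def algebra_simps)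
    qed
  qed
qed

text \<open>After scaling \<open>s\<close> into the unit ball, a root \<open>r\<close> of
  \<open>1 - s * s\<close> commutes with \<open>s\<close>. Since r^2 + s^2 = 1,
  \<open>norm_sq_le_sum_squares\<close> bounds the norm of r^2 = 1 - s^2 by 1, which is the defining
  condition of \<open>pos\<close>.\<close>

lemma pos_square:
  assumes s: "star s = s" shows "pos (s * s)"
proof -
  have *: "pos (s * s)" if s: "star s = s" and n: "norm s \<le> 1" for s :: 'a
  proof -
    have "norm (s * s) \<le> 1" using n by (simp add: norm_sq_selfadjoint[OF s] power_le_one)
    moreover have "star (s * s) = s * s" by (simp add: star_mult s)
    ultimately obtain r where r: "star r = r" "r * r = 1 - s * s"
      "\<And>w. w * (s * s) = (s * s) * w \<Longrightarrow> w * r = r * w"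
      using sqrt_one_minus[of "s * s"] by metis
    have "r * s = s * r" using r(3)[of s] by (simp add: mult.assoc)
    hence "(norm r)\<^sup>2 \<le> 1"
      using norm_sq_le_sum_squares[of r s] r(1,2) s norm_one_le[where 'a = 'a] by simp
    hence "norm (1 - s * s) \<le> 1" using norm_sq_selfadjoint[OF r(1)] r(2) by simp
    thus ?thesis by (auto simp: pos_def star_mult s intro!: exI[of _ 1])
  qed
  show ?thesis
  proof (cases "s = 0")
    case False
    have "pos (((1 / norm s) *\<^sub>R s) * ((1 / norm s) *\<^sub>R s))"
      by (rule *) (use False in \<open>simp_all add: star_scaleR s\<close>)
    from pos_scaleR[OF this, of "norm s * norm s"] show ?thesis using False by simp
  qed simp
qed

text \<open>The roots \<open>r\<close> and \<open>s\<close> inherit commutation, so ab is the square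
  of the selfadjoint element rs.\<close>

lemma pos_mult_commuting:
  assumes "pos a" "pos b" "a * b = b * a" shows "pos (a * b)"
proof -
  obtain r where r: "pos r" "r * r = a" "\<And>w. w * a = a * w \<Longrightarrow> w * r = r * w"
    using pos_sqrt[OF assms(1)] by metis
  obtain s where s: "pos s" "s * s = b" "\<And>w. w * b = b * w \<Longrightarrow> w * s = s * w"
    using pos_sqrt[OF assms(2)] by metis
  have "b * r = r * b" using r(3)[of b] assms(3) by simp
  hence rs: "r * s = s * r" using s(3)[of r] by simp
  have "(r * s) * (r * s) = (r * r) * (s * s)" by (metis mult.assoc rs)
  also have "\<dots> = a * b" by (simp only: r(2) s(2))
  finally show ?thesis using pos_square[of "r * s"] r(1) s(1) rs by (simp add: star_mult pos_selfadjoint)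
qed

lemma pos_norm_minus: "star a = a \<Longrightarrow> norm a \<le> c \<Longrightarrow> pos (c *\<^sub>R 1 - a)"
  unfolding pos_def by (auto simp: star_simps intro!: exI[of _ c] order_trans[OF norm_ge_zero])

text \<open>Commuting roots of \<open>a\<close> and of c - a have squares adding up to c, so
  \<open>norm_sq_le_sum_squares\<close> applies to them.\<close>

lemma norm_le_of_pos:
  assumes "pos a" "pos (c *\<^sub>R 1 - a)" "0 \<le> c" shows "norm a \<le> c"
proof -
  obtain r where r: "pos r" "r * r = a" "\<And>w. w * a = a * w \<Longrightarrow> w * r = r * w"
    using pos_sqrt[OF assms(1)] by metis
  obtain s where s: "pos s" "s * s = c *\<^sub>R 1 - a"
    "\<And>w. w * (c *\<^sub>R 1 - a) = (c *\<^sub>R 1 - a) * w \<Longrightarrow> w * s = s * w"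
    using pos_sqrt[OF assms(2)] by metis
  have "a * r = r * a" by (simp flip: r(2) add: mult.assoc)
  hence "r * s = s * r" using s(3)[of r] by (simp add: algebra_simps)
  hence "(norm r)\<^sup>2 \<le> norm (c *\<^sub>R (1::'a))"
    using norm_sq_le_sum_squares[of r s] r(1,2) s(1,2) by (simp add: pos_selfadjoint)
  thus ?thesis using norm_sq_selfadjoint[of r] r(1,2) norm_scaleR_one_le[OF assms(3), where 'a = 'a]
    by (simp add: pos_selfadjoint)
qed

lemma norm_mono_pos:
  assumes "pos a" "pos (b - a)" shows "norm a \<le> norm b"
proof -
  have "star b = b" using pos_selfadjoint[OF pos_add[OF assms]] by simp
  hence "pos (norm b *\<^sub>R 1 - b)" by (intro pos_norm_minus) auto
  from pos_add[OF this assms(2)] have "pos (norm b *\<^sub>R 1 - a)" by simp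
  thus ?thesis using assms by (intro norm_le_of_pos) auto
qed

lemma pos_uminus_eq_0: "pos a \<Longrightarrow> pos (- a) \<Longrightarrow> a = 0"
  using norm_le_of_pos[of a 0] by simp

text \<open>With \<open>P = y y\<^sup>*\<close>, \<open>N = - y\<^sup>* y\<close> and \<open>K = \<parallel>P\<parallel>\<close> one has \<open>P\<^sup>2 + K P = y (K - N) y\<^sup>*\<close>. The right-hand side has norm at
  most \<open>K\<^sup>2\<close>, the left-hand side dominates \<open>2 P\<^sup>2\<close>.\<close>

lemma neg_star_mult_self_eq_0:
  fixes y :: "'a::unital_cstar_algebra"
  assumes N: "pos (- (star y * y))" shows "y = 0"
proof -
  define u where "u = y + star y"
  define v where "v = \<i> *\<^sub>C (y - star y)"
  define P where "P = y * star y"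
  define K where "K = norm P"
  have K: "K = (norm y)\<^sup>2" by (simp add: K_def P_def cstar_identity')
  have su: "star u = u" by (simp add: u_def star_simps add.commute)
  have sv: "star v = v"
    by (simp add: v_def star_simps star_scaleC scaleC_minus_left flip: scaleC_minus_right)
  \<comment> \<open>Up to real factors \<open>u\<close> and \<open>v\<close> are the real and
    imaginary parts of \<open>y\<close>. Hence \<open>P\<close> is a sum of squares plus the element
    assumed positive.\<close>
  have "u * u + v * v = 2 *\<^sub>R (P + star y * y)"
    by (simp add: u_def v_def P_def scaleC_mult_left scaleC_mult_right scaleC_scaleC scaleC_diff_right scaleC_minus_one
        algebra_simps scaleR_2)
  hence "P = (1/2) *\<^sub>R (u * u + v * v) + - (star y * y)" by simp
  hence P: "pos P" using pos_add[OF pos_scaleR[OF pos_add[OF pos_square[OF su] pos_square[OF sv]]] N]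
    by simp
  have sP: "star P = P" by (simp add: P_def star_simps)
  have "pos (P * (K *\<^sub>R 1 - P))"
    by (intro pos_mult_commuting P pos_norm_minus sP) (simp_all add: K_def algebra_simps)
  hence "pos (K *\<^sub>R P - P * P)" by (simp add: algebra_simps)
  hence "pos ((P * P + K *\<^sub>R P) - 2 *\<^sub>R (P * P))"
    by (simp add: scaleR_2 algebra_simps)
  hence "norm (2 *\<^sub>R (P * P)) \<le> norm (P * P + K *\<^sub>R P)"
    using pos_square[OF sP] by (intro norm_mono_pos pos_scaleR) simp_all
  also have "P * P + K *\<^sub>R P = y * (K *\<^sub>R 1 + star y * y) * star y"
    by (simp add: P_def algebra_simps)
  also have "norm \<dots> \<le> norm y * norm (K *\<^sub>R 1 + star y * y) * norm y"
    using norm_mult_ineq[of "y * (K *\<^sub>R 1 + star y * y)" "star y"] norm_mult_ineq[of y "K *\<^sub>R 1 + star y * y"]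
    by (smt (verit) mult_right_mono norm_ge_zero norm_star)
  also have "norm (K *\<^sub>R 1 + star y * y) \<le> K"
  proof (rule norm_le_of_pos)
    have "norm (- (star y * y)) \<le> K" by (simp add: K cstar_identity)
    from pos_norm_minus[OF _ this] show "pos (K *\<^sub>R 1 + star y * y)" by (simp add: star_simps)
    show "pos (K *\<^sub>R 1 - (K *\<^sub>R 1 + star y * y))" using N by simp
  qed (simp add: K_def)
  hence "norm y * norm (K *\<^sub>R 1 + star y * y) * norm y \<le> norm y * K * norm y"
    by (intro mult_left_mono mult_right_mono) auto
  also have "norm y * K * norm y = K * K" by (simp add: K power2_eq_square)
  also have "norm (2 *\<^sub>R (P * P)) = 2 * (K * K)"
    by (simp add: norm_sq_selfadjoint[OF sP] K_def power2_eq_square)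
  finally have "K * K \<le> 0" by simp
  hence "K = 0" by (metis mult_eq_0_iff zero_le_square order_antisym)
  thus ?thesis by (simp add: K)
qed

text \<open>Here \<open>m\<close> is the absolute value of \<open>b\<close> and
  \<open>n = m - b\<close> is twice its negative part. Then -(xn)*(xn) = n^2 m is positive, so xn =
  0 by \<open>neg_star_mult_self_eq_0\<close>; thus bn = 0, and n^2 = 2nm = -2nb = 0.\<close>

lemma pos_star_mult_self: "pos (star x * x)"
proof -
  define b where "b = star x * x"
  have sb: "star b = b" by (simp add: b_def star_simps)
  obtain m where m: "pos m" "m * m = b * b" "\<And>w. w * (b * b) = (b * b) * w \<Longrightarrow> w * m = m * w"
    using pos_sqrt[OF pos_square[OF sb]] by metis
  have bm: "b * m = m * b" using m(3)[of b] by (simp add: mult.assoc)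
  define n where "n = m - b"
  have sn: "star n = n" by (simp add: n_def star_simps sb pos_selfadjoint[OF m(1)])
  have nm: "n * m = m * n" by (simp add: n_def algebra_simps bm)
  have n1: "n * n = 2 *\<^sub>R (n * m)" by (simp add: n_def algebra_simps bm m(2) scaleR_2)
  have n2: "n * b = - (n * m)" by (simp add: n_def algebra_simps bm m(2))
  have "pos (n * n * m)"
    by (rule pos_mult_commuting[OF pos_square[OF sn] m(1)]) (metis nm mult.assoc)
  moreover have "- (star (x * n) * (x * n)) = n * n * m"
  proof -
    have "star (x * n) * (x * n) = n * b * n" by (simp add: star_simps sn b_def mult.assoc)
    also have "\<dots> = - (n * (n * m))" by (simp add: n2 mult.assoc flip: nm)
    finally show ?thesis by (simp add: mult.assoc)
  qed
  ultimately have "x * n = 0" using neg_star_mult_self_eq_0[of "x * n"] by simp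
  hence "star x * x * n = 0" by (simp add: mult.assoc)
  hence "star (b * n) = 0" by (simp add: b_def)
  hence "n * m = 0" using n2 by (simp add: star_simps sb sn)
  hence "star n * n = 0" using n1 by (simp add: sn)
  hence "b = m" by (simp add: star_mult_self_eq_0 n_def)
  thus ?thesis using m(1) by (simp add: b_def)
qed

lemma pos_conj: "pos a \<Longrightarrow> pos (star x * a * x)"
proof -
  assume "pos a"
  then obtain r where "pos r" "r * r = a" using pos_sqrt by metis
  hence "star x * a * x = star (r * x) * (r * x)" by (simp add: star_simps pos_selfadjoint mult.assoc flip: \<open>r * r = a\<close>)
  thus ?thesis by (simp only: pos_star_mult_self)
qed

text \<open>The dictionary between norm and order, used both to establish membership in the unit
  ball and to exploit it.\<close>

lemma norm_le_one_iff_pos: "norm x \<le> 1 \<longleftrightarrow> pos (1 - star x * x)"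
proof
  assume "norm x \<le> 1"
  hence "norm (star x * x) \<le> 1" by (simp add: cstar_identity power_le_one)
  thus "pos (1 - star x * x)" using pos_norm_minus[of "star x * x" 1] by (simp add: star_simps)
next
  assume "pos (1 - star x * x)"
  hence "norm (star x * x) \<le> 1" using norm_le_of_pos[OF pos_star_mult_self, of 1 x] by simp
  thus "norm x \<le> 1" by (simp add: cstar_identity power2_le_imp_le[of _ 1])
qed

section \<open>Extreme points and partial isometries\<close>

lemma subalgebra_one: "unital_star_subalgebra A \<Longrightarrow> 1 \<in> A"
  and subalgebra_add: "unital_star_subalgebra A \<Longrightarrow> a \<in> A \<Longrightarrow> b \<in> A \<Longrightarrow> a + b \<in> A"
  and subalgebra_mult: "unital_star_subalgebra A \<Longrightarrow> a \<in> A \<Longrightarrow> b \<in> A \<Longrightarrow> a * b \<in> A"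
  and subalgebra_star: "unital_star_subalgebra A \<Longrightarrow> a \<in> A \<Longrightarrow> star a \<in> A"
  and subalgebra_scaleC: "unital_star_subalgebra A \<Longrightarrow> a \<in> A \<Longrightarrow> c *\<^sub>C a \<in> A"
  by (simp_all add: unital_star_subalgebra_def)

lemma subalgebra_scaleR: "unital_star_subalgebra A \<Longrightarrow> a \<in> A \<Longrightarrow> r *\<^sub>R a \<in> A"
  using subalgebra_scaleC[of A a "complex_of_real r"] by (simp add: scaleC_of_real)

lemma subalgebra_diff: "unital_star_subalgebra A \<Longrightarrow> a \<in> A \<Longrightarrow> b \<in> A \<Longrightarrow> a - b \<in> A"
  using subalgebra_add[of A a "(-1) *\<^sub>R b"] subalgebra_scaleR[of A b "-1"] by simp

lemma subalgebra_power: "unital_star_subalgebra A \<Longrightarrow> a \<in> A \<Longrightarrow> a ^ n \<in> A"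
  by (induction n) (simp_all add: subalgebra_one subalgebra_mult)

lemma subalgebra_sum:
  assumes "unital_star_subalgebra A" "\<And>i. i \<in> I \<Longrightarrow> f i \<in> A"
  shows "sum f I \<in> A"
proof -
  have "0 \<in> A"
    using subalgebra_diff[OF assms(1) subalgebra_one[OF assms(1)] subalgebra_one[OF assms(1)]] by simp
  thus ?thesis using assms(2)
    by (induction I rule: infinite_finite_induct) (auto intro: subalgebra_add[OF assms(1)])
qed

lemmas subalgebra_intros = subalgebra_one subalgebra_add subalgebra_mult subalgebra_star
  subalgebra_scaleR subalgebra_diff subalgebra_power subalgebra_sum

lemma subalgebra_UNIV: "unital_star_subalgebra UNIV"
  by (simp add: unital_star_subalgebra_def)

definition is_projection :: "'a::unital_cstar_algebra \<Rightarrow> bool" where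
  "is_projection e \<longleftrightarrow> star e = e \<and> e * e = e"

lemma is_projection_compl: "is_projection e \<Longrightarrow> is_projection (1 - e)"
  by (simp add: is_projection_def star_simps algebra_simps)

lemma norm_is_projection_le:
  assumes "is_projection e" shows "norm e \<le> 1"
proof -
  have "norm e = (norm e)\<^sup>2"
    using assms norm_sq_selfadjoint[of e] by (simp add: is_projection_def)
  thus ?thesis by (cases "e = 0") (auto simp: power2_eq_square)
qed

definition partial_isometry :: "'a::unital_cstar_algebra \<Rightarrow> bool" where
  "partial_isometry x \<longleftrightarrow> x * star x * x = x"

lemma partial_isometry_star:
  assumes "partial_isometry x" shows "partial_isometry (star x)"
  using arg_cong[OF assms[unfolded partial_isometry_def], of star]
  by (simp add: partial_isometry_def star_simps mult.assoc)

lemma partial_isometry_initial: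
  assumes "partial_isometry x"
  shows "is_projection (star x * x)" "x * (1 - star x * x) = 0"
    and "(1 - star x * x) * star x = 0"
proof -
  have x: "x * star x * x = x" using assms by (simp add: partial_isometry_def)
  have "star x * x * (star x * x) = star x * (x * star x * x)" by (simp only: mult.assoc)
  thus "is_projection (star x * x)" by (simp add: x is_projection_def star_simps)
  show "x * (1 - star x * x) = 0" using x by (simp add: algebra_simps)
  from arg_cong[OF this, of star] show "(1 - star x * x) * star x = 0" by (simp add: star_simps)
qed

lemma partial_isometry_final:
  assumes "partial_isometry x"
  shows "is_projection (x * star x)" "star x * (1 - x * star x) = 0"
    and "(1 - x * star x) * x = 0"
  using partial_isometry_initial[OF partial_isometry_star[OF assms]] by (simp_all add: star_star)

text \<open>With e = x*x one computes (x - xe)*(x - xe) = (1 - e)e(1 - e) = 0, so x = xe.\<close>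

lemma partial_isometryI:
  assumes "is_projection (star x * x)" shows "partial_isometry x"
proof -
  define e where "e = star x * x"
  have e: "star e = e" "e * e = e" using assms by (simp_all add: e_def is_projection_def)
  have "star (x - x * e) * (x - x * e) = (1 - e) * e * (1 - e)"
    by (simp add: star_simps e(1) algebra_simps) (simp add: e_def mult.assoc)
  also have "\<dots> = 0" by (simp add: algebra_simps e)
  finally show ?thesis
    by (simp add: star_mult_self_eq_0 partial_isometry_def e_def mult.assoc)
qed

lemma norm_partial_isometry_le:
  assumes "partial_isometry x" shows "norm x \<le> 1"
proof -
  have "(norm x)\<^sup>2 \<le> 1"
    using norm_is_projection_le[OF partial_isometry_initial(1)[OF assms]]
    by (simp add: cstar_identity)
  thus ?thesis by (simp add: power2_le_imp_le[of _ 1])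
qed

text \<open>Kadison's condition relative to the carrier \<open>A\<close>; all three kinds of extreme
  point are compared through it.\<close>

definition full_partial_isometry :: "'a::unital_cstar_algebra \<Rightarrow> 'a set \<Rightarrow> bool" where
  "full_partial_isometry x A \<longleftrightarrow> x \<in> A \<and> partial_isometry x \<and>
     (\<forall>a\<in>A. (1 - x * star x) * a * (1 - star x * x) = 0)"

lemma unit_ball_iff: "x \<in> unit_ball A \<longleftrightarrow> x \<in> A \<and> norm x \<le> 1"
  by (simp add: unit_ball_def)

lemma extreme_point_symmetric:
  fixes x :: "'a::real_vector"
  assumes "x extreme_point_of S" "x + y \<in> S" "x - y \<in> S" shows "y = 0"
proof (rule ccontr)
  assume "y \<noteq> 0"
  have "x = midpoint (x - y) (x + y)"
    by (simp add: midpoint_def scaleR_2[symmetric])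
  moreover have "x - y \<noteq> x + y"
  proof
    assume "x - y = x + y"
    hence "2 *\<^sub>R y = 0" by (simp add: scaleR_2 algebra_simps)
    thus False using \<open>y \<noteq> 0\<close> by simp
  qed
  ultimately have "x \<in> open_segment (x - y) (x + y)"
    by (metis midpoint_in_open_segment)
  thus False using assms by (auto simp: extreme_point_of_def)
qed

text \<open>\<open>c\<close> carries the complement of the initial space of \<open>x\<close> into
  the complement of its final space, so the cross terms vanish. Compressing 1 - c*c by
  \<open>p\<close> gives c*c <= p, hence x*x + c*c <= 1.\<close>

lemma norm_perturbation_le_one:
  assumes x: "partial_isometry x" and c: "norm c \<le> 1"
    and l: "(1 - x * star x) * c = c" and r: "c * (1 - star x * x) = c"
  shows "star (x + c) * (x + c) = star x * x + star c * c" and "norm (x + c) \<le> 1"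
proof -
  define p where "p = 1 - star x * x"
  have p: "is_projection p"
    using is_projection_compl[OF partial_isometry_initial(1)[OF x]] by (simp add: p_def)
  have xc: "star x * c = 0"
    using partial_isometry_final(2)[OF x] by (subst l[symmetric]) (simp flip: mult.assoc)
  have cx: "star c * x = 0" using arg_cong[OF xc, of star] by (simp add: star_simps)
  show eq: "star (x + c) * (x + c) = star x * x + star c * c"
    by (simp add: star_simps algebra_simps xc cx)
  have cp: "c * p = c" using r by (simp add: p_def)
  have pc: "p * star c = star c"
    using arg_cong[OF cp, of star] p by (simp add: star_simps is_projection_def)
  have "pos (star p * (1 - star c * c) * p)"
    using c norm_le_one_iff_pos by (intro pos_conj) blast
  moreover have "star p * (1 - star c * c) * p = p * p - (p * star c) * (c * p)"
    using p by (simp add: is_projection_def algebra_simps)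
  ultimately have "pos (p - star c * c)" using p cp pc by (simp add: is_projection_def)
  thus "norm (x + c) \<le> 1" unfolding norm_le_one_iff_pos eq by (simp add: p_def algebra_simps)
qed

text \<open>The perturbation y = xs/2 with s = 1 - x*x is a polynomial in \<open>x\<close> and
  \<open>star x\<close>, so it stays in \<open>A\<close> although \<open>A\<close> is not assumed
  closed. Once x + y and x - y are known to lie in the ball, extremality gives xs = 0.\<close>

lemma partial_isometry_of_extreme_point:
  assumes A: "unital_star_subalgebra A" and x: "x extreme_point_of unit_ball A"
  shows "partial_isometry x"
proof -
  have xA: "x \<in> A" and nx: "norm x \<le> 1" using x by (auto simp: extreme_point_of_def unit_ball_iff)
  define s where "s = 1 - star x * x"
  define y where "y = (1/2) *\<^sub>R (x * s)"
  have s: "pos s" using nx by (simp add: s_def norm_le_one_iff_pos)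
  have ss: "star s = s" using pos_selfadjoint[OF s] .
  have h: "star x * x = 1 - s" by (simp add: s_def)
  have "pos ((3/4) *\<^sub>R (s * s) + (1/4) *\<^sub>R (s * s * s))"
    by (intro pos_add pos_scaleR pos_mult_commuting s pos_square ss) (simp_all add: mult.assoc)
  \<comment> \<open>As x*x = 1 - s, the product is (1 + s/2)(1 - s)(1 + s/2), whose first-order
    terms in \<open>s\<close> cancel.\<close>
  moreover have "1 - star (x + y) * (x + y) = (3/4) *\<^sub>R (s * s) + (1/4) *\<^sub>R (s * s * s)"
  proof -
    have "star (x + y) * (x + y) = (1 + (1/2) *\<^sub>R s) * (star x * x) * (1 + (1/2) *\<^sub>R s)"
      by (simp add: y_def star_simps ss algebra_simps)
    also have "\<dots> = 1 - ((3/4) *\<^sub>R (s * s) + (1/4) *\<^sub>R (s * s * s))"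
    proof -
      have "(1/2) *\<^sub>R s + (1/2) *\<^sub>R s = s" by (simp flip: scaleR_left_distrib)
      moreover have "(1/4) *\<^sub>R (s * s) + (3/4) *\<^sub>R (s * s) = s * s"
        "(1/2) *\<^sub>R (s * s) + (1/2) *\<^sub>R (s * s) = s * s"
        by (simp_all flip: scaleR_left_distrib)
      ultimately show ?thesis unfolding h by (simp add: algebra_simps)
    qed
    finally show ?thesis by simp
  qed
  ultimately have "norm (x + y) \<le> 1" by (simp only: norm_le_one_iff_pos)
  moreover have "norm (x - y) \<le> 1"
  proof -
    \<comment> \<open>The other point is the average of x and xx*x, both in the ball.\<close>
    have "x - y = (1/2) *\<^sub>R x + (1/2) *\<^sub>R (x * (star x * x))"
      unfolding h y_def by (simp add: algebra_simps flip: scaleR_left_distrib)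
    also have "norm \<dots> \<le> (1/2) * norm x + (1/2) * norm (x * (star x * x))"
      by (rule order_trans[OF norm_triangle_ineq]) simp
    also have "norm (x * (star x * x)) \<le> norm x * (norm x)\<^sup>2"
      using norm_mult_ineq[of x "star x * x"] by (simp add: cstar_identity)
    also have "\<dots> \<le> 1" using nx by (intro mult_le_one) (auto simp: power_le_one)
    finally show ?thesis using nx by simp
  qed
  moreover have "y \<in> A" unfolding y_def s_def by (intro subalgebra_intros A xA)
  ultimately have "y = 0"
    using A xA by (intro extreme_point_symmetric[OF x]) (auto simp: unit_ball_iff intro!: subalgebra_intros)
  thus ?thesis by (simp add: y_def s_def partial_isometry_def algebra_simps)
qed

text \<open>A nonzero corner element, normalised to \<open>c\<close>, could be added to and
  subtracted from \<open>x\<close> inside the ball by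
  \<open>norm_perturbation_le_one\<close>.\<close>

lemma full_partial_isometry_of_extreme_point:
  assumes A: "unital_star_subalgebra A" and x: "x extreme_point_of unit_ball A"
  shows "full_partial_isometry x A"
proof -
  have xA: "x \<in> A" using x by (auto simp: extreme_point_of_def unit_ball_iff)
  have pi: "partial_isometry x" using partial_isometry_of_extreme_point[OF A x] .
  define q where "q = 1 - x * star x"
  define p where "p = 1 - star x * x"
  have p: "p * p = p" and q: "q * q = q"
    using is_projection_compl[OF partial_isometry_initial(1)[OF pi]]
      is_projection_compl[OF partial_isometry_final(1)[OF pi]]
    by (simp_all add: p_def q_def is_projection_def)
  have "q * a * p = 0" if a: "a \<in> A" for a
  proof (rule ccontr)
    assume ne: "q * a * p \<noteq> 0"
    define c where "c = (1 / norm (q * a * p)) *\<^sub>R (q * a * p)"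
    have c: "norm c \<le> 1" "q * c = c" "c * p = c"
      using ne by (simp_all add: c_def mult.assoc p) (simp flip: mult.assoc add: q)
    have "c \<in> A" unfolding c_def p_def q_def by (intro subalgebra_intros A xA a)
    moreover have "norm (x + c) \<le> 1"
      using norm_perturbation_le_one(2)[OF pi, of c] c by (simp add: p_def q_def)
    moreover have "norm (x + - c) \<le> 1"
      using norm_perturbation_le_one(2)[OF pi, of "- c"] c
      by (simp add: p_def q_def del: add_uminus_conv_diff)
    ultimately have "c = 0"
      using A xA by (intro extreme_point_symmetric[OF x]) (auto simp: unit_ball_iff intro!: subalgebra_intros)
    thus False using ne by (simp add: c_def)
  qed
  thus ?thesis using xA pi by (simp add: full_partial_isometry_def p_def q_def)
qed

section \<open>Strong extremality of full partial isometries\<close>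

lemma parallelogram_pos:
  assumes "norm a \<le> 1" "norm b \<le> 1"
  defines "m \<equiv> (1/2) *\<^sub>R (a + b)" and "z \<equiv> (1/2) *\<^sub>R (a - b)"
  shows "pos (1 - star m * m - star z * z)"
proof -
  have "pos ((1/2) *\<^sub>R ((1 - star a * a) + (1 - star b * b)))"
    using assms by (intro pos_scaleR pos_add) (auto simp flip: norm_le_one_iff_pos)
  also have "(1/2) *\<^sub>R ((1 - star a * a) + (1 - star b * b)) = 1 - star m * m - star z * z"
  proof -
    \<comment> \<open>The operator parallelogram law, cleared of denominators: the cross terms of
      m*m and z*z cancel.\<close>
    have "4 *\<^sub>R (star m * m) + 4 *\<^sub>R (star z * z) = 2 *\<^sub>R (star a * a + star b * b)"
      unfolding m_def z_def by (simp add: star_simps algebra_simps scaleR_2)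
    hence "(1/4) *\<^sub>R (4 *\<^sub>R (star m * m) + 4 *\<^sub>R (star z * z)) = (1/4) *\<^sub>R 2 *\<^sub>R (star a * a + star b * b)"
      by simp
    hence "star m * m + star z * z = (1/2) *\<^sub>R (star a * a + star b * b)"
      by (simp add: scaleR_right_distrib)
    moreover have "(1/2) *\<^sub>R (1::'a) + (1/2) *\<^sub>R 1 = 1" by (simp flip: scaleR_left_distrib)
    ultimately show ?thesis by (simp add: algebra_simps)
  qed
  finally show ?thesis .
qed

text \<open>Compressing z*z <= 1 - m*m by e = x*x bounds the squared norm of ze by the norm of e(1 -
  m*m)e, which tends to that of e(1 - e)e = 0.\<close>

lemma half_difference_vanishes_on_initial:
  fixes X Y :: "nat \<Rightarrow> 'a::unital_cstar_algebra"
  assumes pi: "partial_isometry x" and n: "\<And>n. norm (X n) \<le> 1" "\<And>n. norm (Y n) \<le> 1"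
    and lim: "(\<lambda>n. (1/2) *\<^sub>R (X n + Y n)) \<longlonglongrightarrow> x"
  shows "(\<lambda>n. ((1/2) *\<^sub>R (X n - Y n)) * (star x * x)) \<longlonglongrightarrow> 0"
proof -
  define e where "e = star x * x"
  define m where "m n = (1/2) *\<^sub>R (X n + Y n)" for n
  define z where "z n = (1/2) *\<^sub>R (X n - Y n)" for n
  have e: "star e = e" "e * e = e"
    using partial_isometry_initial(1)[OF pi] by (simp_all add: e_def is_projection_def)
  have "(\<lambda>n. norm (e * (1 - star (m n) * m n) * e)) \<longlonglongrightarrow> norm (e * (1 - star x * x) * e)"
    using lim unfolding m_def by (intro tendsto_intros bounded_linear.tendsto[OF bounded_linear_star])
  also have "norm (e * (1 - star x * x) * e) = 0" using e by (simp add: algebra_simps flip: e_def)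
  finally have lim0: "(\<lambda>n. sqrt (norm (e * (1 - star (m n) * m n) * e))) \<longlonglongrightarrow> sqrt 0"
    by (rule tendsto_real_sqrt)
  have "norm (z n * e) \<le> sqrt (norm (e * (1 - star (m n) * m n) * e))" for n
  proof (rule real_le_rsqrt)
    have "pos (star e * (1 - star (m n) * m n - star (z n) * z n) * e)"
      using parallelogram_pos[OF n(1)[of n] n(2)[of n]] unfolding m_def z_def by (rule pos_conj)
    hence "pos (e * (1 - star (m n) * m n) * e - star (z n * e) * (z n * e))"
      by (simp add: star_simps e(1) algebra_simps)
    from norm_mono_pos[OF pos_star_mult_self this]
    show "(norm (z n * e))\<^sup>2 \<le> norm (e * (1 - star (m n) * m n) * e)"
      by (simp add: cstar_identity)
  qed
  hence "(\<lambda>n. z n * e) \<longlonglongrightarrow> 0"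
    by (intro Lim_null_comparison[OF _ lim0[unfolded real_sqrt_zero]] always_eventually) auto
  thus ?thesis by (simp add: z_def e_def)
qed

lemma strongly_extreme_of_full_partial_isometry:
  assumes A: "unital_star_subalgebra A" and x: "full_partial_isometry x A"
  shows "x strongly_extreme_point_of unit_ball A"
proof -
  have pi: "partial_isometry x" and xA: "x \<in> A"
    and full: "\<And>a. a \<in> A \<Longrightarrow> (1 - x * star x) * a * (1 - star x * x) = 0"
    using x by (auto simp: full_partial_isometry_def)
  have "(\<lambda>n. X n - Y n) \<longlonglongrightarrow> 0"
    if XY: "\<And>n. X n \<in> unit_ball A" "\<And>n. Y n \<in> unit_ball A"
      and lim: "(\<lambda>n. (1/2) *\<^sub>R (X n + Y n)) \<longlonglongrightarrow> x" for X Y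
  proof -
    define z where "z n = (1/2) *\<^sub>R (X n - Y n)" for n
    have zA: "z n \<in> A" for n
      using XY by (auto simp: z_def unit_ball_iff intro!: subalgebra_intros A)
    have l1: "(\<lambda>n. z n * (star x * x)) \<longlonglongrightarrow> 0"
      using half_difference_vanishes_on_initial[OF pi _ _ lim] XY by (simp add: z_def unit_ball_iff)
    \<comment> \<open>The same estimate for the adjoint sequences controls the part of
      \<open>z n\<close> that lands in the final space of \<open>x\<close>.\<close>
    have "(\<lambda>n. (1/2) *\<^sub>R (star (X n) + star (Y n))) \<longlonglongrightarrow> star x"
      using bounded_linear.tendsto[OF bounded_linear_star lim] by (simp add: star_simps)
    from half_difference_vanishes_on_initial[OF partial_isometry_star[OF pi] _ _ this]
    have "(\<lambda>n. star (z n) * (x * star x)) \<longlonglongrightarrow> 0"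
      using XY by (simp add: z_def unit_ball_iff star_simps)
    from bounded_linear.tendsto[OF bounded_linear_star this]
    have l2: "(\<lambda>n. x * star x * z n) \<longlonglongrightarrow> 0" by (simp add: star_simps)
    have "2 *\<^sub>R (z n * (star x * x) + x * star x * z n * (1 - star x * x)) = X n - Y n" for n
    proof -
      \<comment> \<open>The piece missing from this splitting of \<open>z n\<close> is the corner
        that \<open>full\<close> annihilates.\<close>
      have "z n = z n * (star x * x) + x * star x * z n * (1 - star x * x)"
        using full[OF zA[of n]] by (simp add: algebra_simps)
      thus ?thesis by (metis z_def scaleR_scaleR scaleR_one nonzero_mult_div_cancel_left
          times_divide_eq_right mult.right_neutral zero_neq_numeral)
    qed
    moreover have "(\<lambda>n. 2 *\<^sub>R (z n * (star x * x) + x * star x * z n * (1 - star x * x)))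
        \<longlonglongrightarrow> 2 *\<^sub>R (0 + 0 * (1 - star x * x))"
      by (intro tendsto_intros l1 l2)
    ultimately show ?thesis by simp
  qed
  thus ?thesis using xA norm_partial_isometry_le[OF pi]
    unfolding strongly_extreme_point_of_def unit_ball_iff by blast
qed

lemma convex_unit_ball:
  assumes "unital_star_subalgebra A" shows "convex (unit_ball A)"
proof -
  have "convex A" unfolding convex_def by (auto intro!: subalgebra_intros assms)
  moreover have "unit_ball A = A \<inter> cball 0 1" by (auto simp: unit_ball_iff)
  ultimately show ?thesis by (simp add: convex_Int)
qed

text \<open>If \<open>x\<close> were interior to a segment from \<open>a\<close> to
  \<open>b\<close>, the constant sequences x + d(b - a) and x - d(b - a) would average to
  \<open>x\<close> with a fixed nonzero difference. The choice d = min u (1 - u) keeps both on the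
  segment.\<close>

lemma extreme_point_of_strongly_extreme:
  assumes S: "convex S" and x: "x strongly_extreme_point_of S"
  shows "x extreme_point_of S"
proof -
  have "x \<notin> open_segment a b" if ab: "a \<in> S" "b \<in> S" for a b
  proof
    assume "x \<in> open_segment a b"
    then obtain u where u: "0 < u" "u < 1" "x = (1 - u) *\<^sub>R a + u *\<^sub>R b" and ne: "a \<noteq> b"
      by (auto simp: in_segment)
    define d where "d = min u (1 - u)"
    have d: "0 < d" "d \<le> u" "d \<le> 1 - u" using u by (auto simp: d_def)
    have seg: "(1 - v) *\<^sub>R a + v *\<^sub>R b \<in> S" if "0 \<le> v" "v \<le> 1" for v
      using S ab that by (auto simp: convex_def)
    have 1: "x + d *\<^sub>R (b - a) \<in> S"
      using seg[of "u + d"] d(1,3) u(1,2) unfolding u(3) by (simp add: algebra_simps)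
    have 2: "x - d *\<^sub>R (b - a) \<in> S"
      using seg[of "u - d"] d(1,2) u(1,2) unfolding u(3) by (simp add: algebra_simps)
    have "(1/2) *\<^sub>R ((x + d *\<^sub>R (b - a)) + (x - d *\<^sub>R (b - a))) = x"
      by (simp flip: scaleR_2)
    hence "(\<lambda>_::nat. (1/2) *\<^sub>R ((x + d *\<^sub>R (b - a)) + (x - d *\<^sub>R (b - a)))) \<longlonglongrightarrow> x"
      by (simp only: tendsto_const)
    moreover have strong: "(\<forall>n. X n \<in> S \<and> Y n \<in> S) \<and> (\<lambda>n. (1/2) *\<^sub>R (X n + Y n)) \<longlonglongrightarrow> x \<Longrightarrow>
        (\<lambda>n. X n - Y n) \<longlonglongrightarrow> 0" for X Y :: "nat \<Rightarrow> 'a"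
      using x unfolding strongly_extreme_point_of_def by blast
    ultimately have "(\<lambda>_::nat. (x + d *\<^sub>R (b - a)) - (x - d *\<^sub>R (b - a))) \<longlonglongrightarrow> 0"
      using 1 2 strong[of "\<lambda>_. x + d *\<^sub>R (b - a)" "\<lambda>_. x - d *\<^sub>R (b - a)"] by blast
    hence "(x + d *\<^sub>R (b - a)) - (x - d *\<^sub>R (b - a)) = 0" by (simp add: LIMSEQ_const_iff)
    hence "(2 * d) *\<^sub>R (b - a) = 0" by (simp flip: scaleR_scaleR add: scaleR_2)
    thus False using d ne by simp
  qed
  thus ?thesis using x by (auto simp: extreme_point_of_def strongly_extreme_point_of_def)
qed

section \<open>Strong limits and polar decomposition\<close>

lemma von_neumann_subalgebra: "von_neumann_algebra M \<Longrightarrow> unital_star_subalgebra M"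
  by (simp add: von_neumann_algebra_def)

lemma commutantD: "T \<in> commutant M \<Longrightarrow> S \<in> M \<Longrightarrow> T * S = S * T"
  by (simp add: commutant_def)

text \<open>The bicommutant serves as the membership test, so topological closure arguments for
  \<open>M\<close> reduce to commutation.\<close>

lemma von_neumann_memI:
  assumes "von_neumann_algebra M" "\<And>T. T \<in> commutant M \<Longrightarrow> a * T = T * a"
  shows "a \<in> M"
proof -
  have "a \<in> commutant (commutant M)" using assms(2) by (simp add: commutant_def[of "commutant M"])
  thus ?thesis using assms(1) by (simp add: von_neumann_algebra_def)
qed

lemma commutant_star:
  assumes M: "unital_star_subalgebra M" and T: "T \<in> commutant M"
  shows "star T \<in> commutant M"
proof -
  have "star T * S = S * star T" if "S \<in> M" for S
    using arg_cong[OF commutantD[OF T subalgebra_star[OF M that]], of star] by (simp add: star_simps)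
  thus ?thesis by (simp add: commutant_def)
qed

text \<open>The root commutes with whatever commutes with \<open>a\<close>, in particular with the
  whole commutant.\<close>

lemma von_neumann_sqrt:
  assumes M: "von_neumann_algebra M" and a: "a \<in> M" "pos a"
  obtains r where "pos r" "r * r = a" "r \<in> M" "\<And>w. w * a = a * w \<Longrightarrow> w * r = r * w"
proof -
  obtain r where r: "pos r" "r * r = a" "\<And>w. w * a = a * w \<Longrightarrow> w * r = r * w"
    using pos_sqrt[OF a(2)] by metis
  have "r \<in> M" using r(3) commutantD[OF _ a(1)] by (intro von_neumann_memI[OF M]) metis
  thus ?thesis using that r by blast
qed

lemma inner_star: "inner (cop_apply T x) y = inner x (cop_apply (star T) y)"
  by (simp add: cinner_star flip: Re_cinner)

lemma inner_star_mult_self: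
  "inner x (cop_apply (star T * T) y) = inner (cop_apply T x) (cop_apply T y)"
  by (simp add: cop_apply_times inner_star)

lemma norm_cop_apply_sq: "(norm (cop_apply T x))\<^sup>2 = inner x (cop_apply (star T * T) x)"
  by (simp add: inner_star_mult_self power2_norm_eq_inner)

lemma cop_eqI_inner:
  "(\<And>x y. inner x (cop_apply S y) = inner x (cop_apply T y)) \<Longrightarrow> S = T"
  by (rule cop_eqI, rule inner_eq_imp_eq)

lemma inner_pos_nonneg:
  assumes "pos a" shows "0 \<le> inner x (cop_apply a x)"
proof -
  obtain r where r: "pos r" "r * r = a" using pos_sqrt[OF assms] by metis
  have "inner x (cop_apply a x) = (norm (cop_apply r x))\<^sup>2"
    using r by (simp add: norm_cop_apply_sq pos_selfadjoint)
  thus ?thesis by simp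
qed

text \<open>Sequences suffice in place of nets, since every limit below is taken along powers,
  partial sums or decreasing projections.\<close>

definition strong_lim :: "(nat \<Rightarrow> 'h::chilbert_space cop) \<Rightarrow> 'h cop \<Rightarrow> bool" where
  "strong_lim T S \<longleftrightarrow> (\<forall>x. (\<lambda>n. cop_apply (T n) x) \<longlonglongrightarrow> cop_apply S x)"

lemma strong_lim_unique:
  assumes "strong_lim T R" "strong_lim T S" shows "R = S"
  using assms unfolding strong_lim_def by (intro cop_eqI) (blast intro: LIMSEQ_unique)

lemma strong_lim_const: "strong_lim (\<lambda>_. T) T"
  by (simp add: strong_lim_def)

lemma strong_lim_add:
  "strong_lim R A \<Longrightarrow> strong_lim S B \<Longrightarrow> strong_lim (\<lambda>n. R n + S n) (A + B)"
  by (simp add: strong_lim_def cop_apply_simps tendsto_add)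

lemma strong_lim_diff:
  "strong_lim R A \<Longrightarrow> strong_lim S B \<Longrightarrow> strong_lim (\<lambda>n. R n - S n) (A - B)"
  by (simp add: strong_lim_def cop_apply_simps tendsto_diff)

lemma strong_lim_mult_left: "strong_lim T S \<Longrightarrow> strong_lim (\<lambda>n. R * T n) (R * S)"
  by (simp add: strong_lim_def cop_apply_times bounded_linear.tendsto[OF bounded_linear_cop_apply])

lemma strong_lim_mult_right: "strong_lim T S \<Longrightarrow> strong_lim (\<lambda>n. T n * R) (S * R)"
  by (simp add: strong_lim_def cop_apply_times)

lemma strong_lim_subseq: "strong_lim T S \<Longrightarrow> strict_mono f \<Longrightarrow> strong_lim (\<lambda>n. T (f n)) S"
  unfolding strong_lim_def by (auto intro: filterlim_compose dest: filterlim_subseq)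

lemma strong_lim_Suc: "strong_lim T S \<Longrightarrow> strong_lim (\<lambda>n. T (Suc n)) S"
  by (rule strong_lim_subseq) (auto simp: strict_mono_def)

lemma strong_lim_mem:
  assumes M: "von_neumann_algebra M" and T: "\<And>n. T n \<in> M" and lim: "strong_lim T S"
  shows "S \<in> M"
proof (rule von_neumann_memI[OF M])
  fix R assume "R \<in> commutant M"
  hence "(\<lambda>n. R * T n) = (\<lambda>n. T n * R)" using commutantD T by blast
  thus "S * R = R * S"
    using strong_lim_mult_left[OF lim, of R] strong_lim_mult_right[OF lim, of R] strong_lim_unique
    by metis
qed

text \<open>The adjoint is not strongly continuous, so convergence of the adjoints is a hypothesis;
  inner products then match the two limits.\<close>

lemma strong_lim_star:
  assumes "strong_lim T S" "strong_lim (\<lambda>n. star (T n)) R" shows "star S = R"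
proof (rule cop_eqI_inner)
  fix x y
  have "(\<lambda>n. inner (cop_apply (T n) x) y) \<longlonglongrightarrow> inner (cop_apply S x) y"
    using assms by (auto simp: strong_lim_def intro: tendsto_inner)
  moreover have "(\<lambda>n. inner x (cop_apply (star (T n)) y)) \<longlonglongrightarrow> inner x (cop_apply R y)"
    using assms by (auto simp: strong_lim_def intro: tendsto_inner)
  ultimately show "inner x (cop_apply (star S) y) = inner x (cop_apply R y)"
    by (simp add: inner_star LIMSEQ_unique)
qed

text \<open>The adjoint factor is moved to the other side of the inner product, where strong
  convergence of \<open>T\<close> alone decides the limit.\<close>

lemma strong_lim_star_mult_self:
  assumes "strong_lim T S" "strong_lim (\<lambda>n. star (T n) * T n) R" shows "star S * S = R"
proof (rule cop_eqI_inner)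
  fix x y
  have "(\<lambda>n. inner (cop_apply (T n) x) (cop_apply (T n) y)) \<longlonglongrightarrow> inner (cop_apply S x) (cop_apply S y)"
    using assms by (auto simp: strong_lim_def intro: tendsto_inner)
  moreover have "(\<lambda>n. inner x (cop_apply (star (T n) * T n) y)) \<longlonglongrightarrow> inner x (cop_apply R y)"
    using assms by (auto simp: strong_lim_def intro: tendsto_inner)
  ultimately show "inner x (cop_apply (star S * S) y) = inner x (cop_apply R y)"
    by (simp add: inner_star_mult_self LIMSEQ_unique)
qed

lemma strong_lim_exists:
  fixes T :: "nat \<Rightarrow> 'h::chilbert_space cop"
  assumes bd: "\<And>n. norm (T n) \<le> C" and cau: "\<And>x. Cauchy (\<lambda>n. cop_apply (T n) x)"
  obtains S where "strong_lim T S"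
proof -
  have "\<exists>l. (\<lambda>n. cop_apply (T n) x) \<longlonglongrightarrow> l" for x
    using cau[of x] by (simp add: Cauchy_convergent_iff convergent_def)
  then obtain f where f: "\<And>x. (\<lambda>n. cop_apply (T n) x) \<longlonglongrightarrow> f x" by metis
  note lin = bounded_linear_cop_apply[THEN linear_simps(1)] bounded_linear_cop_apply[THEN linear_simps(5)]
  have sc: "f (c *\<^sub>C x) = c *\<^sub>C f x" for c x
  proof (rule LIMSEQ_unique[OF f])
    show "(\<lambda>n. cop_apply (T n) (c *\<^sub>C x)) \<longlonglongrightarrow> c *\<^sub>C f x"
      unfolding cop_apply_scaleC by (rule bounded_linear.tendsto[OF bounded_linear_scaleC f])
  qed
  have "bounded_linear f"
  proof (rule bounded_linear_intro[where K = C])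
    show "f (x + y) = f x + f y" for x y
      by (rule LIMSEQ_unique[OF f]) (simp add: lin tendsto_add f)
    show "f (r *\<^sub>R x) = r *\<^sub>R f x" for r x
      using sc[of "complex_of_real r" x] by (simp add: scaleC_of_real)
    have "norm (cop_apply (T n) x) \<le> norm x * C" for n x
      using norm_cop_apply[of "T n" x] mult_right_mono[OF bd[of n] norm_ge_zero[of x]]
      by (simp add: mult.commute)
    thus "norm (f x) \<le> norm x * C" for x
      by (intro LIMSEQ_le_const2[OF tendsto_norm[OF f]]) auto
  qed
  then obtain S where "cop_apply S = f" using cop_exists[of f] sc by blast
  thus ?thesis using f that[of S] by (simp add: strong_lim_def)
qed

text \<open>The scalars \<open>a x n\<close> decrease and are bounded below, hence form a Cauchy
  sequence, and their differences dominate the squared distances of the vectors.\<close>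

lemma strong_lim_exists_of_decreasing:
  fixes T :: "nat \<Rightarrow> 'h::chilbert_space cop" and a :: "'h \<Rightarrow> nat \<Rightarrow> real"
  assumes bd: "\<And>n. norm (T n) \<le> C" and a0: "\<And>x n. 0 \<le> a x n"
    and step: "\<And>x m n. m \<le> n \<Longrightarrow> (norm (cop_apply (T n - T m) x))\<^sup>2 \<le> a x m - a x n"
  obtains S where "strong_lim T S"
proof (rule strong_lim_exists[OF bd])
  fix x
  have "decseq (a x)"
    unfolding decseq_def using step[of _ _ x] zero_le_power2 by (meson diff_ge_0_iff_ge order_trans)
  hence "convergent (a x)" using decseq_convergent[of "a x" 0] a0 convergentI by metis
  hence ca: "Cauchy (a x)" by (rule convergent_Cauchy)
  show "Cauchy (\<lambda>n. cop_apply (T n) x)"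
  proof (rule metric_CauchyI)
    fix e :: real assume e: "0 < e"
    then obtain N where N: "\<And>m n. m \<ge> N \<Longrightarrow> n \<ge> N \<Longrightarrow> dist (a x m) (a x n) < e\<^sup>2"
      using ca by (meson metric_CauchyD zero_less_power)
    have *: "dist (cop_apply (T n) x) (cop_apply (T m) x) < e" if "m \<ge> N" "m \<le> n" for m n
    proof (rule power2_less_imp_less)
      have "dist (a x m) (a x n) < e\<^sup>2" using N that by simp
      thus "(dist (cop_apply (T n) x) (cop_apply (T m) x))\<^sup>2 < e\<^sup>2"
        using step[OF that(2), of x] by (simp add: dist_norm cop_apply_simps)
    qed (use e in simp)
    have "dist (cop_apply (T m) x) (cop_apply (T n) x) < e" if "m \<ge> N" "n \<ge> N" for m n
      using *[of m n] *[of n m] that by (cases "n \<le> m") (auto simp: dist_commute)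
    thus "\<exists>N. \<forall>m\<ge>N. \<forall>n\<ge>N. dist (cop_apply (T m) x) (cop_apply (T n) x) < e" by blast
  qed
qed (use that in blast)

lemma power_add_self: "c ^ n * c ^ n = c ^ (n + n)" for c :: "'a::monoid_mult"
  by (simp add: power_add)

text \<open>With k = |x| and c = 1 - k, the powers c^n decrease strongly to the projection
  \<open>F\<close> onto the kernel of \<open>k\<close>. Neumann-type partial sums of powers of
  \<open>c\<close> act as approximate inverses of \<open>k\<close>, and \<open>v\<close> is the
  strong limit of \<open>x\<close> times these sums; no Borel functional calculus enters.\<close>

lemma polar_decomposition:
  fixes x :: "'h::chilbert_space cop"
  assumes M: "von_neumann_algebra M" and xM: "x \<in> M" and nx: "norm x \<le> 1"
  obtains v k where "v \<in> M" "k \<in> M" "partial_isometry v" "pos k" "norm k \<le> 1" "x = v * k"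
proof -
  note A = von_neumann_subalgebra[OF M]
  obtain k where k: "pos k" "k * k = star x * x" "k \<in> M"
    using von_neumann_sqrt[OF M _ pos_star_mult_self, of x] subalgebra_intros[OF A] xM by metis
  have sk: "star k = k" using pos_selfadjoint[OF k(1)] .
  have "(norm k)\<^sup>2 = (norm x)\<^sup>2" using norm_sq_selfadjoint[OF sk] k(2) by (simp add: cstar_identity)
  hence nk: "norm k \<le> 1" using nx by (simp add: power2_eq_iff_nonneg)
  define c where "c = 1 - k"
  have sc: "star (c ^ n) = c ^ n" for n by (simp add: c_def star_simps star_power sk)
  have pc: "pos c" using pos_norm_minus[OF sk nk] by (simp add: c_def)
  have pcn: "pos (c ^ n)" for n
    by (induction n) (simp_all add: pos_mult_commuting[OF pc] power_commutes)
  have p1c: "pos (1 - c ^ n)" for n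
  proof (induction n)
    case (Suc n)
    have "pos (c ^ n * k)"
      by (rule pos_mult_commuting[OF pcn k(1)])
        (use power_commutes[of c n] in \<open>simp add: c_def algebra_simps\<close>)
    moreover have "1 - c ^ Suc n = (1 - c ^ n) + c ^ n * k"
      by (simp add: power_Suc2 del: power_Suc) (simp add: c_def algebra_simps)
    ultimately show ?case using Suc by (simp only: pos_add)
  qed simp
  have ncn: "norm (1 - c ^ n) \<le> 1" "norm (c ^ n) \<le> 1" for n
    using norm_le_of_pos[of "1 - c ^ n" 1] norm_le_of_pos[of "c ^ n" 1] p1c pcn by simp_all
  define a where "a \<xi> n = inner \<xi> (cop_apply (c ^ n) \<xi>)" for \<xi> n
  have a0: "0 \<le> a \<xi> n" for \<xi> n unfolding a_def by (rule inner_pos_nonneg[OF pcn])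
  \<comment> \<open>The difference d = c^m - c^n lies between 0 and 1, whence d^2 <= d. This is the
    estimate required by \<open>strong_lim_exists_of_decreasing\<close>.\<close>
  have sq: "inner \<xi> (cop_apply ((c ^ m - c ^ n) * (c ^ m - c ^ n)) \<xi>) \<le> a \<xi> m - a \<xi> n"
    if "m \<le> n" for \<xi> m n
  proof -
    define d where "d = c ^ m - c ^ n"
    have "d = c ^ m * (1 - c ^ (n - m))" using that by (simp add: d_def algebra_simps flip: power_add)
    moreover have "pos (c ^ m * (1 - c ^ (n - m)))"
      by (rule pos_mult_commuting[OF pcn p1c]) (simp add: algebra_simps add.commute flip: power_add)
    ultimately have d: "pos d" by simp
    have "pos ((1 - c ^ m) + c ^ n)" by (intro pos_add p1c pcn)
    hence "pos (1 - d)" by (simp add: d_def algebra_simps)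
    hence "pos (d * (1 - d))" using d by (intro pos_mult_commuting) (auto simp: algebra_simps)
    from inner_pos_nonneg[OF this, of \<xi>]
    show ?thesis
      by (simp add: d_def[symmetric] a_def inner_diff_right[symmetric] cop_apply_simps(3)[symmetric])
        (simp add: algebra_simps cop_apply_simps inner_diff_right)
  qed
  obtain F where F: "strong_lim (\<lambda>n. c ^ n) F"
  proof (rule strong_lim_exists_of_decreasing[OF ncn(2) a0])
    show "(norm (cop_apply (c ^ n - c ^ m) \<xi>))\<^sup>2 \<le> a \<xi> m - a \<xi> n" if "m \<le> n" for \<xi> m n
    proof -
      have "(c ^ n - c ^ m) * (c ^ n - c ^ m) = (c ^ m - c ^ n) * (c ^ m - c ^ n)"
        by (simp add: algebra_simps)
      thus ?thesis using sq[OF that, of \<xi>] by (simp add: norm_cop_apply_sq star_diff sc)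
    qed
  qed
  have F2: "strong_lim (\<lambda>n. c ^ (n + n)) F"
    by (rule strong_lim_subseq[OF F]) (auto simp: strict_mono_def)
  have sF: "star F = F" using strong_lim_star[OF F] F by (simp add: sc)
  have cF: "c * F = F"
    using strong_lim_unique[OF strong_lim_mult_left[OF F, of c]] strong_lim_Suc[OF F] by simp
  \<comment> \<open>The even powers c^n c^n have the same limit \<open>F\<close>.\<close>
  have FF: "F * F = F"
    using strong_lim_star_mult_self[OF F, of F] F2 by (simp add: sc sF power_add_self)
  define S where "S n = (\<Sum>j<n. c ^ j)" for n
  have sS: "star (S n) = S n" for n by (simp add: S_def star_sum sc)
  have kS: "k * S n = 1 - c ^ n" for n
    by (induction n) (simp_all add: S_def algebra_simps, simp add: c_def algebra_simps)
  have Sk: "S n * k = 1 - c ^ n" for n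
    using arg_cong[OF kS[of n], of star] by (simp add: star_simps sS sk sc)
  define T where "T n = x * S n" for n
  have xx: "star x * (x * w) = k * (k * w)" for w using k(2) by (simp flip: mult.assoc)
  have TT: "star (T n) * T n = (1 - c ^ n) * (1 - c ^ n)" for n
    by (simp add: T_def star_simps sS mult.assoc xx kS) (simp add: Sk flip: mult.assoc)
  \<comment> \<open>The increments of \<open>T\<close> have the same absolute square as those of the
    powers of \<open>c\<close>, so \<open>sq\<close> yields convergence a second time.\<close>
  have TTd: "star (T n - T m) * (T n - T m) = (c ^ m - c ^ n) * (c ^ m - c ^ n)" for m n
  proof -
    have "T n - T m = x * (S n - S m)" by (simp add: T_def algebra_simps)
    hence "star (T n - T m) * (T n - T m) = ((S n - S m) * k) * (k * (S n - S m))"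
      by (simp add: star_simps sS mult.assoc xx)
    also have "(S n - S m) * k = c ^ m - c ^ n" by (simp add: left_diff_distrib Sk)
    also have "k * (S n - S m) = c ^ m - c ^ n" by (simp add: right_diff_distrib kS)
    finally show ?thesis .
  qed
  have nT: "norm (T n) \<le> 1" for n
  proof (rule power2_le_imp_le)
    have "(norm (T n))\<^sup>2 = norm ((1 - c ^ n) * (1 - c ^ n))" by (simp flip: cstar_identity TT)
    also have "\<dots> \<le> 1 * 1" by (rule order_trans[OF norm_mult_ineq]) (intro mult_mono ncn; simp)
    finally show "(norm (T n))\<^sup>2 \<le> 1\<^sup>2" by simp
  qed simp
  obtain v where v: "strong_lim T v"
  proof (rule strong_lim_exists_of_decreasing[OF nT a0])
    show "(norm (cop_apply (T n - T m) \<xi>))\<^sup>2 \<le> a \<xi> m - a \<xi> n" if "m \<le> n" for \<xi> m n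
      unfolding norm_cop_apply_sq TTd by (rule sq[OF that])
  qed
  have "T n \<in> M" for n
    unfolding T_def S_def c_def by (intro subalgebra_intros A xM k)
  hence vM: "v \<in> M" using strong_lim_mem[OF M _ v] by blast
  \<comment> \<open>The square (1 - c^n)^2 is expanded so that only sums of known strong limits
    occur.\<close>
  have "strong_lim (\<lambda>n. 1 - c ^ n - c ^ n + c ^ (n + n)) (1 - F - F + F)"
    by (intro strong_lim_add strong_lim_diff strong_lim_const F F2)
  moreover have "star (T n) * T n = 1 - c ^ n - c ^ n + c ^ (n + n)" for n
    by (simp add: TT algebra_simps power_add_self)
  ultimately have "star v * v = 1 - F"
    using strong_lim_star_mult_self[OF v] by simp
  moreover have "is_projection (1 - F)"
    using sF FF by (intro is_projection_compl) (simp add: is_projection_def)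
  ultimately have pv: "partial_isometry v" using partial_isometryI by metis
  have "T n * k = x * (1 - c ^ n)" for n by (simp add: T_def mult.assoc Sk)
  hence "v * k = x * (1 - F)"
    using strong_lim_mult_right[OF v, of k]
      strong_lim_mult_left[OF strong_lim_diff[OF strong_lim_const F], of x 1] strong_lim_unique
    by simp
  \<comment> \<open>\<open>x\<close> and \<open>k\<close> have the same kernel because x*x = k^2,
    and \<open>F\<close> maps into the kernel of \<open>k\<close>.\<close>
  moreover have "x * F = 0"
  proof -
    have kF: "k * F = 0" using cF by (simp add: c_def algebra_simps)
    have "star (x * F) * (x * F) = F * (k * (k * F))" by (simp add: star_simps sF mult.assoc xx)
    thus ?thesis by (simp add: kF star_mult_self_eq_0)
  qed
  ultimately have "x = v * k" by (simp add: algebra_simps)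
  thus ?thesis using that vM k nk pv by blast
qed

section \<open>From C*-extreme points to full partial isometries\<close>

lemma cstar_extreme_pointD:
  assumes "cstar_extreme_point_of_ball x A"
    and "\<And>i. i \<in> {1..k::nat} \<Longrightarrow> y i \<in> unit_ball A" "\<And>i. i \<in> {1..k} \<Longrightarrow> invertible_in A (t i)"
    and "(\<Sum>i = 1..k. star (t i) * t i) = 1" "x = (\<Sum>i = 1..k. star (t i) * y i * t i)"
  shows "\<exists>u. \<forall>i\<in>{1..k}. unitary_in A (u i) \<and> y i = star (u i) * x * u i"
  by (rule assms(1)[unfolded cstar_extreme_point_of_ball_def, THEN conjunct2, THEN spec[of _ k],
        THEN spec[of _ y], THEN spec[of _ t], THEN mp])
    (intro conjI ballI assms(2-))

text \<open>A midpoint is the C*-convex combination with both coefficients equal to 1 divided by the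
  square root of 2, so C*-extremality makes \<open>a\<close> unitarily equivalent to
  \<open>x\<close>.\<close>

lemma cstar_extreme_average:
  assumes A: "unital_star_subalgebra A" and x: "cstar_extreme_point_of_ball x A"
    and a: "a \<in> unit_ball A" and b: "b \<in> unit_ball A" and eq: "x = (1/2) *\<^sub>R (a + b)"
  obtains u where "unitary_in A u" "a = star u * x * u"
proof -
  define y where "y i = (if i = (1::nat) then a else b)" for i
  define t where "t = (\<lambda>_::nat. (1 / sqrt 2) *\<^sub>R (1::'a))"
  have two: "{1..2::nat} = {1, 2}" by auto
  have "(1 / sqrt 2) * (1 / sqrt 2) = (1/2 :: real)" by simp
  hence tt: "star (t i) * t i = (1/2) *\<^sub>R 1" "star (t i) * w * t i = (1/2) *\<^sub>R w" for i w
    by (simp_all add: t_def star_scaleR)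
  have "invertible_in A (t i)" for i
    unfolding invertible_in_def t_def
    by (intro conjI bexI[of _ "sqrt 2 *\<^sub>R 1"]) (auto intro!: subalgebra_intros A)
  moreover have "(\<Sum>i = 1..2::nat. star (t i) * t i) = 1"
    unfolding two tt by (simp flip: scaleR_left_distrib)
  moreover have "x = (\<Sum>i = 1..2::nat. star (t i) * y i * t i)"
    unfolding two tt by (simp add: y_def eq scaleR_right_distrib)
  moreover have "y i \<in> unit_ball A" for i using a b by (simp add: y_def)
  ultimately obtain u where "\<forall>i\<in>{1..2}. unitary_in A (u i) \<and> y i = star (u i) * x * u i"
    using cstar_extreme_pointD[OF x, of 2 y t] by blast
  hence "unitary_in A (u 1) \<and> y 1 = star (u 1) * x * u 1" by auto
  thus ?thesis using that[of "u 1"] by (simp add: y_def)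
qed

lemma partial_isometry_unitary_conj:
  assumes u: "unitary_in A u" and p: "partial_isometry (star u * x * u)"
  shows "partial_isometry x"
proof -
  have u1: "u * (star u * w) = w" "star u * (u * w) = w" for w
    using u by (simp_all add: unitary_in_def flip: mult.assoc)
  have "star u * (x * (star x * (x * u))) = star u * (x * u)"
    using p by (simp add: partial_isometry_def star_simps mult.assoc u1)
  hence "u * (star u * (x * (star x * (x * u)))) * star u = u * (star u * (x * u)) * star u"
    by simp
  moreover have "u * star u = 1" using u by (simp add: unitary_in_def)
  ultimately show ?thesis by (simp add: u1 partial_isometry_def mult.assoc)
qed

lemma partial_isometry_mult_unitary:
  assumes u: "unitary_in A u" and v: "partial_isometry v"
  shows "partial_isometry (v * u)"
proof -
  have "u * (star u * w) = w" for w using u by (simp add: unitary_in_def flip: mult.assoc)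
  moreover have "v * (star v * (v * w)) = v * w" for w
    using v by (simp add: partial_isometry_def flip: mult.assoc)
  ultimately show ?thesis by (simp add: partial_isometry_def star_simps mult.assoc)
qed

lemma norm_unitary_le:
  assumes "unitary_in A u" shows "norm u \<le> 1"
proof (rule power2_le_imp_le)
  have "(norm u)\<^sup>2 = norm (star u * u)" by (rule cstar_identity[symmetric])
  also have "star u * u = 1" using assms by (simp add: unitary_in_def)
  finally show "(norm u)\<^sup>2 \<le> 1\<^sup>2" using norm_one_le[where 'a = 'a] by simp
qed simp

text \<open>The unitary is k + is, with \<open>s\<close> the root of 1 - k^2. It is unitary because
  \<open>s\<close> commutes with \<open>k\<close>, and in \<open>M\<close> because roots stay in
  \<open>M\<close>.\<close>

lemma average_of_unitaries:
  assumes M: "von_neumann_algebra M" and k: "k \<in> M" "star k = k" "norm k \<le> 1"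
  obtains u where "unitary_in M u" "unitary_in M (star u)" "k = (1/2) *\<^sub>R (u + star u)"
proof -
  note A = von_neumann_subalgebra[OF M]
  have "norm (k * k) \<le> 1" using k by (simp add: norm_sq_selfadjoint power_le_one)
  hence "pos (1 - k * k)" using pos_norm_minus[of "k * k" 1] k by (simp add: star_mult)
  moreover have "1 - k * k \<in> M" by (intro subalgebra_intros A k)
  ultimately obtain s where s: "pos s" "s * s = 1 - k * k" "s \<in> M"
    "\<And>w. w * (1 - k * k) = (1 - k * k) * w \<Longrightarrow> w * s = s * w"
    using von_neumann_sqrt[OF M] by metis
  have ks: "k * s = s * k" by (rule s(4)) (simp add: algebra_simps)
  define u where "u = k + \<i> *\<^sub>C s"
  have su: "star u = k - \<i> *\<^sub>C s"
    using k pos_selfadjoint[OF s(1)] scaleC_minus_left by (simp add: u_def star_add star_scaleC)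
  have uu: "star u * u = 1" "u * star u = 1"
    unfolding su by (simp_all add: u_def algebra_simps scaleC_mult_left scaleC_mult_right
        scaleC_scaleC scaleC_diff_right scaleC_add_right scaleC_minus_one ks s(2))
  have uM: "u \<in> M" unfolding u_def by (intro subalgebra_add subalgebra_scaleC A k s)
  have "k = (1/2) *\<^sub>R (u + star u)" unfolding su by (simp add: u_def flip: scaleR_2)
  moreover have "star u \<in> M" by (intro subalgebra_star A uM)
  ultimately show ?thesis using that[of u] uu uM by (simp add: unitary_in_def star_star)
qed

lemma partial_isometry_of_cstar_extreme:
  assumes M: "von_neumann_algebra M" and x: "cstar_extreme_point_of_ball x M"
  shows "partial_isometry x"
proof -
  note A = von_neumann_subalgebra[OF M]
  have "x \<in> M" "norm x \<le> 1" using x by (simp_all add: cstar_extreme_point_of_ball_def unit_ball_iff)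
  then obtain v k where vk: "v \<in> M" "k \<in> M" "partial_isometry v" "pos k" "norm k \<le> 1" "x = v * k"
    using polar_decomposition[OF M] by metis
  obtain u where u: "unitary_in M u" "unitary_in M (star u)" "k = (1/2) *\<^sub>R (u + star u)"
    using average_of_unitaries[OF M vk(2) pos_selfadjoint[OF vk(4)] vk(5)] by metis
  have ball: "v * w \<in> unit_ball M" if "unitary_in M w" for w
    using that vk(1) norm_mult_ineq[of v w] mult_le_one[OF norm_partial_isometry_le[OF vk(3)] norm_ge_zero norm_unitary_le[OF that]]
    by (auto simp: unit_ball_iff unitary_in_def intro: subalgebra_intros A)
  have "x = (1/2) *\<^sub>R (v * u + v * star u)"
    unfolding vk(6) by (subst u(3)) (simp add: algebra_simps)
  then obtain w where "unitary_in M w" "v * u = star w * x * w"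
    using cstar_extreme_average[OF A x ball[OF u(1)] ball[OF u(2)]] by metis
  thus ?thesis
    using partial_isometry_mult_unitary[OF u(1) vk(3)] partial_isometry_unitary_conj by metis
qed

lemma full_partial_isometry_of_cstar_extreme:
  assumes M: "von_neumann_algebra M" and x: "cstar_extreme_point_of_ball x M"
  shows "full_partial_isometry x M"
proof -
  note A = von_neumann_subalgebra[OF M]
  have xM: "x \<in> M" using x by (simp add: cstar_extreme_point_of_ball_def unit_ball_iff)
  have pi: "partial_isometry x" by (rule partial_isometry_of_cstar_extreme[OF M x])
  define q where "q = 1 - x * star x"
  define p where "p = 1 - star x * x"
  have p: "p * p = p" "star p = p" and q: "q * q = q"
    using is_projection_compl[OF partial_isometry_initial(1)[OF pi]]
      is_projection_compl[OF partial_isometry_final(1)[OF pi]]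
    by (simp_all add: p_def q_def is_projection_def)
  have idem: "star c * c * (star c * c) = star c * c"
    if c: "c \<in> M" "norm c \<le> 1" "q * c = c" "c * p = c" for c
  proof -
    define b where "b = star c * c"
    note pert = norm_perturbation_le_one[OF pi, folded p_def q_def]
    have "x + c \<in> unit_ball M" "x + - c \<in> unit_ball M"
      using pert(2)[of c] pert(2)[of "- c"] c subalgebra_intros(2,6)[OF A xM c(1)]
      by (auto simp: unit_ball_iff)
    moreover have "x = (1/2) *\<^sub>R ((x + c) + (x + - c))" by (simp flip: scaleR_2)
    ultimately obtain u where u: "unitary_in M u" "x + c = star u * x * u"
      using cstar_extreme_average[OF A x] by metis
    have "unitary_in M (star u)"
      using u(1) subalgebra_star[OF A] by (simp add: unitary_in_def star_star)
    moreover have "star (star u) * (x + c) * star u = x"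
      using u by (simp add: unitary_in_def star_star mult.assoc) (simp add: unitary_in_def flip: mult.assoc)
    ultimately have "partial_isometry (x + c)"
      using partial_isometry_unitary_conj[of M "star u" "x + c"] pi by simp
    \<comment> \<open>The initial projection of x + c is (1 - p) + c*c with c*c living under
      \<open>p\<close>, so its idempotence is that of c*c.\<close>
    from partial_isometry_initial(1)[OF this]
    have "is_projection (1 - p + star c * c)" using pert(1)[of c] c by (simp add: p_def)
    moreover have "star c * c * p = star c * c" using c(4) by (simp add: mult.assoc)
    moreover have "p * star c = star c" using arg_cong[OF c(4), of star] p by (simp add: star_simps)
    hence "p * (star c * c) = star c * c" by (simp flip: mult.assoc)
    ultimately show ?thesis
      using p unfolding b_def[symmetric] by (simp add: is_projection_def algebra_simps)
  qed
  have "q * a * p = 0" if a: "a \<in> M" for a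
  proof (rule ccontr)
    assume ne: "q * a * p \<noteq> 0"
    define c where "c = (1 / norm (q * a * p)) *\<^sub>R (q * a * p)"
    have c: "norm c \<le> 1" "q * c = c" "c * p = c" "c \<noteq> 0"
      using ne by (simp_all add: c_def mult.assoc p) (simp flip: mult.assoc add: q)
    have cM: "c \<in> M" unfolding c_def p_def q_def by (intro subalgebra_intros A xM a)
    define b where "b = star c * c"
    have "b * b = b" using idem[OF cM] c by (simp add: b_def)
    \<comment> \<open>Halving \<open>c\<close> preserves the hypotheses of \<open>idem\<close>, and
      b and b/4 are both idempotent only if b = 0.\<close>
    moreover have "(1/4) *\<^sub>R b * (1/4) *\<^sub>R b = (1/4) *\<^sub>R b"
      using idem[of "(1/2) *\<^sub>R c"] c subalgebra_scaleR[OF A cM] by (simp add: b_def star_scaleR)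
    ultimately have "(1/16) *\<^sub>R b = (1/4) *\<^sub>R b" by simp
    hence "b = 0" by simp
    thus False using c(4) by (simp add: b_def star_mult_self_eq_0)
  qed
  thus ?thesis using xM pi by (simp add: full_partial_isometry_def p_def q_def)
qed

section \<open>Similar isometries\<close>

lemma mult_eq_assoc: "a * b = c \<Longrightarrow> a * (b * w) = c * w" for a b c w :: "'a::semigroup_mult"
  by (simp flip: mult.assoc)

text \<open>\<open>t\<close> maps the range of \<open>e\<close> bijectively onto that of
  \<open>f\<close> with inverse \<open>s\<close>, and \<open>v\<close> is the unitary part of this
  restriction. The inverse of g = (te)*(te) on the range of \<open>e\<close> is explicitly sfs*, so
  its root \<open>r\<close> serves as the inverse of |te|. The clause on \<open>r\<close> lets
  \<open>v\<close> inherit intertwining relations from \<open>t\<close>.\<close>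

lemma polar_isometry_of_invertible:
  assumes M: "von_neumann_algebra M" and ts: "t \<in> M" "s \<in> M" "t * s = 1" "s * t = 1"
    and e: "is_projection e" "e \<in> M" and f: "is_projection f" "f \<in> M"
    and te: "f * t * e = t * e" and sf: "e * s * f = s * f"
  obtains v r where "v \<in> M" "star v * v = e" "v * star v = f" "v = t * e * r"
    "\<And>w. w * (s * f * star s) = (s * f * star s) * w \<Longrightarrow> w * r = r * w"
proof -
  note A = von_neumann_subalgebra[OF M]
  have ee: "star e = e" "e * e = e" and ff: "star f = f" "f * f = f"
    using e f by (simp_all add: is_projection_def)
  define g' where "g' = s * f * star s"
  define g where "g = e * star t * t * e"
  have "g' = star (f * star s) * (f * star s)"
    by (simp add: g'_def star_simps ff mult.assoc mult_eq_assoc[OF ff(2)])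
  hence pg: "pos g'" by (simp only: pos_star_mult_self)
  have "g' \<in> M" unfolding g'_def by (intro subalgebra_intros A ts f)
  then obtain r where r: "pos r" "r * r = g'" "r \<in> M" "\<And>w. w * g' = g' * w \<Longrightarrow> w * r = r * w"
    using von_neumann_sqrt[OF M _ pg] by metis
  have sr: "star r = r" using pos_selfadjoint[OF r(1)] .
  have sg': "star g' = g'" using pos_selfadjoint[OF pg] .
  have sg: "star g = g" by (simp add: g_def star_simps ee mult.assoc)
  have eg': "e * g' = g'" using sf by (simp add: g'_def flip: mult.assoc)
  have g'e: "g' * e = g'" using arg_cong[OF eg', of star] by (simp add: star_simps sg' ee)
  have tf: "e * star t * f = e * star t"
    using arg_cong[OF te, of star] by (simp add: star_simps ee ff mult.assoc)
  have "g * g' = (e * star t) * t * (e * s * f) * star s" by (simp add: g_def g'_def mult.assoc)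
  also have "\<dots> = (e * star t) * (t * s) * f * star s" unfolding sf by (simp only: mult.assoc)
  also have "\<dots> = (e * star t * f) * star s" by (simp add: ts mult.assoc)
  also have "\<dots> = e * star (s * t)" unfolding tf by (simp only: star_mult mult.assoc)
  finally have gg': "g * g' = e" by (simp add: ts)
  have g'g: "g' * g = e" using arg_cong[OF gg', of star] by (simp add: star_simps sg sg' ee)
  \<comment> \<open>Both \<open>e\<close> and \<open>g\<close> commute with \<open>g'\<close>, hence
    with its root.\<close>
  have er: "e * r = r * e" using r(4)[of e] eg' g'e by simp
  have gr: "g * r = r * g" using r(4)[of g] gg' g'g by simp
  define v where "v = t * e * r"
  have "star v * v = r * (g * r)" by (simp add: v_def g_def star_simps sr ee mult.assoc)
  also have "\<dots> = e" using g'g by (simp add: gr r(2) mult_eq_assoc[OF r(2)])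
  finally have 1: "star v * v = e" .
  have "v * star v = t * (e * (r * r) * e) * star t" by (simp add: v_def star_simps sr ee mult.assoc)
  also have "\<dots> = (t * s) * f * star (t * s)" unfolding r(2) eg' g'e by (simp add: g'_def star_simps mult.assoc)
  also have "\<dots> = f" by (simp add: ts)
  finally have 2: "v * star v = f" .
  have "v \<in> M" unfolding v_def by (intro subalgebra_intros A ts e r)
  thus ?thesis using that[of v r] 1 2 v_def r(4) unfolding g'_def by blast
qed

section \<open>Range projections, wandering spaces and the Wold decomposition\<close>

lemma isometry_power:
  assumes "star y * y = (1::'a::unital_cstar_algebra)"
  shows "star y ^ n * y ^ n = 1"
proof (induction n)
  case (Suc n)
  have "star y ^ Suc n * y ^ Suc n = star y ^ n * (star y * y) * y ^ n"
    by (simp only: power_Suc2[of "star y"] power_Suc[of y] mult.assoc)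
  thus ?case using Suc assms by simp
qed simp

text \<open>When \<open>w\<close> carries the wandering space 1 - xx* onto 1 - yy*, the k-th term
  carries the k-th shifted copy of the one onto that of the other. These are the partial sums of the
  partial isometry matching the shift parts of \<open>x\<close> and \<open>y\<close>.\<close>

definition wandering_sum :: "'a::unital_cstar_algebra \<Rightarrow> 'a \<Rightarrow> 'a \<Rightarrow> nat \<Rightarrow> 'a" where
  "wandering_sum x y w n = (\<Sum>k<n. y ^ k * w * star x ^ k)"

text \<open>For an isometry \<open>x\<close> this is the projection onto the range of x^n; the limit
  in \<open>n\<close> projects onto the unitary part in the Wold decomposition.\<close>

definition range_proj :: "'a::unital_cstar_algebra \<Rightarrow> nat \<Rightarrow> 'a" where
  "range_proj x n = x ^ n * star x ^ n"

lemma range_proj_mult: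
  assumes xx: "star x * x = 1" and mn: "m \<le> n"
  shows "range_proj x m * range_proj x n = range_proj x n"
proof -
  have "range_proj x m * range_proj x n = x ^ m * (star x ^ m * x ^ m) * x ^ (n - m) * star x ^ n"
    using mn by (simp add: range_proj_def mult.assoc flip: power_add[of x m "n - m"])
  also have "\<dots> = range_proj x n"
    using mn by (simp add: isometry_power[OF xx] range_proj_def flip: power_add)
  finally show ?thesis .
qed

lemma star_range_proj: "star (range_proj x n) = range_proj x n"
  by (simp add: range_proj_def star_simps star_power)

lemma is_projection_range_proj: "star x * x = 1 \<Longrightarrow> is_projection (range_proj x n)"
  by (simp add: is_projection_def star_range_proj range_proj_mult)

lemma pos_range_proj: "pos (range_proj x n)"
  using pos_star_mult_self[of "star x ^ n"] by (simp add: range_proj_def star_simps star_power)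

lemma range_proj_Suc: "range_proj x (Suc n) = x * range_proj x n * star x"
  by (simp add: range_proj_def mult.assoc power_commutes)

text \<open>A difference of nested projections is itself a projection; the shape suits
  \<open>strong_lim_exists_of_decreasing\<close>.\<close>

lemma range_proj_diff_sq:
  assumes xx: "star x * x = 1" and mn: "m \<le> n"
  shows "star (range_proj x n - range_proj x m) * (range_proj x n - range_proj x m)
    = range_proj x m - range_proj x n"
proof -
  note mn = range_proj_mult[OF assms]
  have "range_proj x n * range_proj x m = range_proj x n"
    using arg_cong[OF mn, of star] by (simp add: star_mult star_range_proj)
  thus ?thesis using mn range_proj_mult[OF xx order_refl]
    by (simp add: star_simps star_range_proj algebra_simps)
qed

text \<open>\<open>e\<close> projects onto the intersection of the ranges of the x^n. Passing to the
  limit in \<open>range_proj_Suc\<close> gives xex* = e, and multiplying by \<open>x\<close> on the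
  right shows that \<open>e\<close> reduces \<open>x\<close>.\<close>

lemma strong_lim_range_proj:
  fixes x :: "'h::chilbert_space cop"
  assumes M: "von_neumann_algebra M" and x: "x \<in> M" "star x * x = 1"
  obtains e where "strong_lim (range_proj x) e" "e \<in> M" "is_projection e"
    "x * e = e * x" "x * e * star x = e" "\<And>n. range_proj x n * e = e"
proof -
  note A = von_neumann_subalgebra[OF M]
  obtain e where e: "strong_lim (range_proj x) e"
  proof (rule strong_lim_exists_of_decreasing)
    show "norm (range_proj x n) \<le> 1" for n
      by (rule norm_is_projection_le[OF is_projection_range_proj[OF x(2)]])
    show "0 \<le> inner \<xi> (cop_apply (range_proj x n) \<xi>)" for \<xi> n
      by (rule inner_pos_nonneg[OF pos_range_proj])
    show "(norm (cop_apply (range_proj x n - range_proj x m) \<xi>))\<^sup>2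
        \<le> inner \<xi> (cop_apply (range_proj x m) \<xi>) - inner \<xi> (cop_apply (range_proj x n) \<xi>)"
      if "m \<le> n" for \<xi> m n
      unfolding norm_cop_apply_sq range_proj_diff_sq[OF x(2) that]
      by (simp add: cop_apply_simps inner_diff_right)
  qed
  have eM: "e \<in> M"
    by (rule strong_lim_mem[OF M _ e]) (auto simp: range_proj_def intro!: subalgebra_intros A x)
  have se: "star e = e" using strong_lim_star[OF e] e by (simp add: star_range_proj)
  have "star e * e = e"
    using strong_lim_star_mult_self[OF e] e by (simp add: star_range_proj range_proj_mult[OF x(2)])
  hence pe: "is_projection e" using se by (simp add: is_projection_def)
  have "strong_lim (\<lambda>n. x * range_proj x n * star x) (x * e * star x)"
    by (intro strong_lim_mult_left strong_lim_mult_right e)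
  hence xex: "x * e * star x = e"
    using strong_lim_unique strong_lim_Suc[OF e] by (simp add: range_proj_Suc) blast
  hence "x * e = e * x" using x(2) by (metis mult.assoc mult.right_neutral)
  moreover have "range_proj x n * e = e" for n
  proof (rule strong_lim_unique)
    have lim: "strong_lim (\<lambda>m. range_proj x (n + m)) e"
      by (rule strong_lim_subseq[OF e]) (auto simp: strict_mono_def)
    from strong_lim_mult_left[OF this, of "range_proj x n"]
    show "strong_lim (\<lambda>m. range_proj x (n + m)) (range_proj x n * e)"
      by (simp add: range_proj_mult[OF x(2)])
    show "strong_lim (\<lambda>m. range_proj x (n + m)) e" by (rule lim)
  qed
  ultimately show ?thesis using that e eM pe xex by blast
qed

lemma wandering_isometry:
  assumes xx: "star x * x = 1" and yy: "star y * y = 1"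
    and ww: "star w * w = 1 - x * star x" "w * star w = 1 - y * star y"
  shows "star y * w = 0" "star w * y = 0" "w * x = 0"
proof -
  have "is_projection (x * star x)"
    using xx by (simp add: is_projection_def star_simps mult.assoc mult_eq_assoc[OF xx])
  hence pw: "partial_isometry w" by (intro partial_isometryI) (simp add: ww is_projection_compl)
  have "w = w * star w * w" using pw by (simp add: partial_isometry_def)
  hence "star y * w = star y * (1 - y * star y) * w" by (metis ww(2) mult.assoc)
  also have "\<dots> = 0" by (simp add: algebra_simps mult_eq_assoc[OF yy])
  finally show 1: "star y * w = 0" .
  from arg_cong[OF this, of star] show "star w * y = 0" by (simp add: star_simps)
  have "w = w * (star w * w)" using pw by (simp add: partial_isometry_def mult.assoc)
  hence "w * x = w * ((1 - x * star x) * x)" by (metis ww(1) mult.assoc)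
  also have "\<dots> = 0" by (simp add: algebra_simps xx)
  finally show "w * x = 0" .
qed

text \<open>Distinct terms have orthogonal ranges, so only diagonal products survive. Each equals
  \<open>range_proj x k - range_proj x (Suc k)\<close>, and these telescope.\<close>

lemma wandering_sum_diff_sq:
  assumes xx: "star x * x = 1" and yy: "star y * y = 1"
    and ww: "star w * w = 1 - x * star x" "w * star w = 1 - y * star y" and mn: "m \<le> n"
  shows "star (wandering_sum x y w n - wandering_sum x y w m) * (wandering_sum x y w n - wandering_sum x y w m)
    = range_proj x m - range_proj x n"
proof -
  let ?U = "wandering_sum x y w"
  note wi = wandering_isometry[OF xx yy ww]
  have rec: "?U (Suc n) = ?U n + y ^ n * w * star x ^ n" for n by (simp add: wandering_sum_def)
  \<comment> \<open>The first \<open>n\<close> terms map into the complement of the range of y^n,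
    where the next term begins.\<close>
  have Uy: "star (?U n) * y ^ n = 0" for n
  proof (induction n)
    case (Suc n)
    have "star (?U (Suc n)) * y ^ Suc n
        = star (?U n) * y ^ n * y + x ^ n * star w * (star y ^ n * y ^ n) * y"
      by (simp add: rec[of n] star_simps star_power distrib_right mult.assoc power_commutes)
    also have "\<dots> = 0" using Suc.IH by (simp add: isometry_power[OF yy] mult.assoc wi)
    finally show ?case .
  qed (simp add: wandering_sum_def)
  show ?thesis using mn
  proof (induction n rule: dec_induct)
    case (step n)
    define D where "D = ?U n - ?U m"
    define c where "c = y ^ n * w * star x ^ n"
    have "y ^ n = y ^ m * y ^ (n - m)" using step by (simp flip: power_add)
    hence "star (?U m) * y ^ n = 0" by (simp add: Uy flip: mult.assoc)
    hence "star D * y ^ n = 0" by (simp add: D_def star_diff left_diff_distrib Uy)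
    hence Dc: "star D * c = 0" by (simp add: c_def flip: mult.assoc)
    have cD: "star c * D = 0" using arg_cong[OF Dc, of star] by (simp add: star_simps)
    have "star c * c = x ^ n * star w * (star y ^ n * y ^ n) * w * star x ^ n"
      by (simp add: c_def star_simps star_power mult.assoc)
    also have "\<dots> = x ^ n * (star w * w) * star x ^ n"
      by (simp add: isometry_power[OF yy] mult.assoc)
    also have "\<dots> = range_proj x n - range_proj x (Suc n)"
      by (simp add: ww range_proj_def algebra_simps power_Suc2[of x] power_Suc[of "star x"]
          del: power_Suc)
    finally have cc: "star c * c = range_proj x n - range_proj x (Suc n)" .
    have "?U (Suc n) - ?U m = D + c" by (simp add: rec D_def c_def)
    hence "star (?U (Suc n) - ?U m) * (?U (Suc n) - ?U m) = star D * D + star c * c"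
      by (simp add: star_add distrib_left distrib_right Dc cD)
    thus ?case using step by (simp add: cc D_def)
  qed simp
qed

lemma strong_lim_wandering_sum:
  fixes x y w :: "'h::chilbert_space cop"
  assumes xx: "star x * x = 1" and yy: "star y * y = 1"
    and ww: "star w * w = 1 - x * star x" "w * star w = 1 - y * star y"
    and e: "strong_lim (range_proj x) e"
  obtains W where "strong_lim (wandering_sum x y w) W" "star W * W = 1 - e" "W * x = y * W"
proof -
  let ?U = "wandering_sum x y w"
  note diff = wandering_sum_diff_sq[OF xx yy ww]
  have UU: "star (?U n) * ?U n = 1 - range_proj x n" for n
    using diff[of 0 n] by (simp add: wandering_sum_def range_proj_def)
  have nU: "norm (?U n) \<le> 1" for n
  proof (rule power2_le_imp_le)
    have "(norm (?U n))\<^sup>2 = norm (1 - range_proj x n)" by (simp flip: cstar_identity UU)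
    also have "\<dots> \<le> 1"
      by (intro norm_is_projection_le is_projection_compl is_projection_range_proj xx)
    finally show "(norm (?U n))\<^sup>2 \<le> 1\<^sup>2" by simp
  qed simp
  obtain W where W: "strong_lim ?U W"
  proof (rule strong_lim_exists_of_decreasing[OF nU])
    show "0 \<le> inner \<xi> (cop_apply (range_proj x n) \<xi>)" for \<xi> n
      by (rule inner_pos_nonneg[OF pos_range_proj])
    show "(norm (cop_apply (?U n - ?U m) \<xi>))\<^sup>2
        \<le> inner \<xi> (cop_apply (range_proj x m) \<xi>) - inner \<xi> (cop_apply (range_proj x n) \<xi>)"
      if "m \<le> n" for \<xi> m n
      unfolding norm_cop_apply_sq diff[OF that] by (simp add: cop_apply_simps inner_diff_right)
  qed
  have "star W * W = 1 - e"
    using strong_lim_star_mult_self[OF W] strong_lim_diff[OF strong_lim_const e, of 1] by (simp add: UU)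
  moreover have "W * x = y * W"
  proof (rule strong_lim_unique)
    have "?U (Suc n) * x = y * ?U n" for n
    proof -
      \<comment> \<open>Split off the term k = 0: multiplying by \<open>x\<close> on the right then
        kills \<open>w\<close> and cancels \<open>star x\<close>.\<close>
      have "?U (Suc n) = w + y * ?U n * star x"
        by (simp add: wandering_sum_def sum.lessThan_Suc_shift sum_distrib_left sum_distrib_right
            mult.assoc power_commutes del: sum.lessThan_Suc)
      thus ?thesis by (simp add: distrib_right wandering_isometry[OF xx yy ww] mult.assoc xx)
    qed
    thus "strong_lim (\<lambda>n. y * ?U n) (W * x)"
      using strong_lim_mult_right[OF strong_lim_Suc[OF W], of x] by simp
    show "strong_lim (\<lambda>n. y * ?U n) (y * W)" by (rule strong_lim_mult_left[OF W])
  qed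
  ultimately show ?thesis using that W by blast
qed

text \<open>Since y^n t = t x^n, a vector in the range of every x^n is sent into the range of every
  y^n.\<close>

lemma intertwiner_preserves_range_lim:
  fixes x y t :: "'h::chilbert_space cop"
  assumes xx: "star x * x = 1" and yy: "star y * y = 1" and yt: "y * t = t * x"
    and e: "\<And>n. range_proj x n * e = e" and f: "strong_lim (range_proj y) f"
  shows "f * t * e = t * e"
proof -
  have yn: "y ^ n * t = t * x ^ n" for n
  proof (induction n)
    case (Suc n)
    have "y ^ Suc n * t = y * (y ^ n * t)" by (simp add: mult.assoc)
    also have "\<dots> = (y * t) * x ^ n" by (simp add: Suc mult.assoc)
    finally show ?case by (simp add: yt mult.assoc)
  qed simp
  have "range_proj y n * (t * e) = t * e" for n
  proof -
    have "t * e = t * x ^ n * star x ^ n * e"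
      using e[of n] by (simp add: range_proj_def mult.assoc)
    hence te: "t * e = y ^ n * t * star x ^ n * e" by (simp add: yn)
    have "range_proj y n * (t * e) = y ^ n * (star y ^ n * y ^ n) * t * star x ^ n * e"
      by (subst te) (simp add: range_proj_def mult.assoc)
    thus ?thesis by (simp add: isometry_power[OF yy] te[symmetric])
  qed
  hence "f * (t * e) = t * e"
    using strong_lim_mult_right[OF f, of "t * e"] strong_lim_const[of "t * e"] strong_lim_unique
    by simp
  thus ?thesis by (simp add: mult.assoc)
qed

text \<open>The unitary is W + v. On the unitary parts \<open>v\<close> is the polar part of
  \<open>t\<close>; on the shift parts \<open>W\<close> extends a partial isometry between the
  wandering spaces.\<close>

lemma similar_isometries_unitarily_equivalent:
  fixes x y t s :: "'h::chilbert_space cop"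
  assumes M: "von_neumann_algebra M" and mem: "x \<in> M" "y \<in> M" "t \<in> M" "s \<in> M"
    and xx: "star x * x = 1" and yy: "star y * y = 1"
    and ts: "t * s = 1" "s * t = 1" and yt: "y * t = t * x"
  obtains u where "unitary_in M u" "y * u = u * x"
proof -
  note A = von_neumann_subalgebra[OF M]
  have "s * (y * t) * s = s * (t * x) * s" by (simp add: yt)
  hence sy: "x * s = s * y"
    by (simp add: mult.assoc ts mult_eq_assoc[OF ts(2)])
  have tys: "star t * star y = star x * star t" "star s * star x = star y * star s"
    using arg_cong[OF yt, of star] arg_cong[OF sy, of star] by (simp_all add: star_mult)
  have sts: "star s * star t = 1" "star t * star s = 1"
    using ts by (simp_all flip: star_mult)
  obtain e where e: "strong_lim (range_proj x) e" "e \<in> M" "is_projection e" "x * e = e * x"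
    "x * e * star x = e" "\<And>n. range_proj x n * e = e"
    using strong_lim_range_proj[OF M mem(1) xx] by metis
  obtain f where f: "strong_lim (range_proj y) f" "f \<in> M" "is_projection f" "y * f = f * y"
    "y * f * star y = f" "\<And>n. range_proj y n * f = f"
    using strong_lim_range_proj[OF M mem(2) yy] by metis
  have te: "f * t * e = t * e" by (rule intertwiner_preserves_range_lim[OF xx yy yt e(6) f(1)])
  have sf: "e * s * f = s * f" by (rule intertwiner_preserves_range_lim[OF yy xx sy f(6) e(1)])
  obtain v r where v: "v \<in> M" "star v * v = e" "v * star v = f" "v = t * e * r"
    and r: "\<And>w. w * (s * f * star s) = (s * f * star s) * w \<Longrightarrow> w * r = r * w"
    using polar_isometry_of_invertible[OF M mem(3,4) ts e(3,2) f(3,2) te sf] by metis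
  have yv: "y * v = v * x"
  proof -
    define g where "g = s * f * star s"
    \<comment> \<open>Invariance of \<open>g\<close> under conjugation by \<open>x\<close> makes
      \<open>g\<close>, and hence \<open>r\<close>, commute with \<open>x\<close>; so
      \<open>v\<close> intertwines just as \<open>t\<close> does.\<close>
    have "x * g * star x = (x * s) * f * (star s * star x)" by (simp add: g_def mult.assoc)
    also have "\<dots> = s * (y * f * star y) * star s" unfolding sy tys by (simp only: mult.assoc)
    finally have "x * g * star x = g" by (simp only: f(5) g_def)
    hence "g * x = x * g * (star x * x)" by (metis mult.assoc)
    hence "x * r = r * x" using r[of x] by (simp add: xx g_def)
    have "y * v = (y * t) * e * r" by (simp add: v(4) mult.assoc)
    also have "\<dots> = t * (x * e) * r" by (simp add: yt mult.assoc)
    also have "\<dots> = t * e * (x * r)" by (simp only: e(4) mult.assoc)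
    also have "\<dots> = v * x" by (simp only: \<open>x * r = r * x\<close> v(4) mult.assoc)
    finally show ?thesis .
  qed
  have px: "is_projection (1 - x * star x)" and py: "is_projection (1 - y * star y)"
    by (rule is_projection_compl, simp add: is_projection_def star_simps mult.assoc
        mult_eq_assoc[OF xx] mult_eq_assoc[OF yy])+
  have pm: "1 - x * star x \<in> M" "1 - y * star y \<in> M" "star s \<in> M" "star t \<in> M"
    by (intro subalgebra_intros A mem)+
  have xq: "star x * (1 - x * star x) = 0" and yq: "star y * (1 - y * star y) = 0"
    by (simp_all add: right_diff_distrib mult_eq_assoc[OF xx] mult_eq_assoc[OF yy])
  \<comment> \<open>The adjoints of \<open>s\<close> and \<open>t\<close> map the kernels of
    \<open>star x\<close> and \<open>star y\<close> onto each other, so the two wandering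
    projections are equivalent in \<open>M\<close>.\<close>
  have "star y * (star s * (1 - x * star x)) = star s * (star x * (1 - x * star x))"
    by (simp only: tys mult.assoc[symmetric])
  hence "star y * (star s * (1 - x * star x)) = 0" by (simp only: xq mult_zero_right)
  hence c1: "(1 - y * star y) * star s * (1 - x * star x) = star s * (1 - x * star x)"
    by (simp add: left_diff_distrib mult.assoc)
  have "star x * (star t * (1 - y * star y)) = star t * (star y * (1 - y * star y))"
    by (simp only: tys mult.assoc[symmetric])
  hence "star x * (star t * (1 - y * star y)) = 0" by (simp only: yq mult_zero_right)
  hence c2: "(1 - x * star x) * star t * (1 - y * star y) = star t * (1 - y * star y)"
    by (simp add: left_diff_distrib mult.assoc)
  obtain w where w: "w \<in> M" "star w * w = 1 - x * star x" "w * star w = 1 - y * star y"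
    using polar_isometry_of_invertible[OF M pm(3,4) sts px pm(1) py pm(2) c1 c2] by metis
  obtain W where W: "strong_lim (wandering_sum x y w) W" "star W * W = 1 - e" "W * x = y * W"
    using strong_lim_wandering_sum[OF xx yy w(2,3) e(1)] by metis
  have w': "star (star w) * star w = 1 - y * star y" "star w * star (star w) = 1 - x * star x"
    by (simp_all add: star_star w)
  obtain W' where W': "strong_lim (wandering_sum y x (star w)) W'" "star W' * W' = 1 - f"
    using strong_lim_wandering_sum[OF yy xx w' f(1)] by metis
  \<comment> \<open>The adjoint is a wandering sum with \<open>x\<close> and \<open>y\<close>
    exchanged, which supplies the final projection of \<open>W\<close>.\<close>
  have "star (wandering_sum x y w n) = wandering_sum y x (star w) n" for n
    by (simp add: wandering_sum_def star_sum star_simps star_power mult.assoc)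
  hence "star W = W'" using strong_lim_star[OF W(1)] W'(1) by simp
  hence WW: "W * star W = 1 - f" using W'(2) by (auto simp: star_star)
  have WM: "W \<in> M"
    by (rule strong_lim_mem[OF M _ W(1)])
      (auto simp: wandering_sum_def intro!: subalgebra_intros A mem w)
  have ee: "star e = e" "e * e = e" and ff: "star f = f" "f * f = f"
    using e(3) f(3) by (simp_all add: is_projection_def)
  have "partial_isometry v" using v(2) e(3) by (intro partial_isometryI) simp
  hence "v * star v * v = v" by (simp add: partial_isometry_def)
  hence fv: "f * v = v" and ve: "v * e = v"
    unfolding v(2,3)[symmetric] by (simp_all only: mult.assoc)
  have "star (star W * f) * (star W * f) = f * (W * star W) * f"
    by (simp add: star_simps ff mult.assoc)
  hence "star W * f = 0" by (simp add: WW algebra_simps ff star_mult_self_eq_0)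
  hence Wv: "star W * v = 0" by (metis fv mult.assoc mult_zero_left)
  hence vW: "star v * W = 0" by (metis star_mult star_star star_zero)
  have "star (W * e) * (W * e) = e * (star W * W) * e"
    by (simp add: star_simps ee mult.assoc)
  hence We: "W * e = 0" by (simp add: W(2) algebra_simps ee star_mult_self_eq_0)
  have "e * star v = star v" using arg_cong[OF ve, of star] by (simp add: star_simps ee)
  hence Wv': "W * star v = 0" by (metis We mult.assoc mult_zero_left)
  hence vW': "v * star W = 0" by (metis star_mult star_star star_zero)
  show ?thesis
  proof (rule that)
    show "unitary_in M (W + v)"
      by (simp add: unitary_in_def subalgebra_add[OF A WM v(1)] star_simps distrib_left distrib_right
          W(2) WW v(2,3) Wv vW Wv' vW')
    show "y * (W + v) = (W + v) * x" by (simp add: distrib_left distrib_right W(3) yv)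
  qed
qed

section \<open>C*-convex combinations equal to an isometry\<close>

lemma pos_sum_eq_0:
  assumes fin: "finite I" and p: "\<And>i. i \<in> I \<Longrightarrow> pos (f i)" and 0: "sum f I = 0" and i: "i \<in> I"
  shows "f i = 0"
proof (rule pos_uminus_eq_0[OF p[OF i]])
  have "- f i = sum f (I - {i})" using fin i 0 by (simp add: sum.remove add_eq_0_iff2)
  also have "pos \<dots>" by (intro pos_sum p) auto
  finally show "pos (- f i)" .
qed

text \<open>A variance argument: the positive terms d*d, measuring the failure of yt = tx, and
  \<open>g\<close>, measuring the failure of \<open>y\<close> to be isometric, add up to 1 - x*x =
  0. Hence each term vanishes.\<close>

lemma isometry_as_cstar_convex_combination:
  fixes t y :: "'i \<Rightarrow> 'a::unital_cstar_algebra"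
  assumes fin: "finite I" and xx: "star x * x = 1" and t1: "(\<Sum>i\<in>I. star (t i) * t i) = 1"
    and x: "x = (\<Sum>i\<in>I. star (t i) * y i * t i)"
    and y: "\<And>i. i \<in> I \<Longrightarrow> norm (y i) \<le> 1" and i: "i \<in> I" and ts: "t i * s = 1"
  shows "y i * t i = t i * x" "star (y i) * y i = 1"
proof -
  define d where "d i = y i * t i - t i * x" for i
  define g where "g i = star (t i) * (1 - star (y i) * y i) * t i" for i
  have sx: "star x = (\<Sum>i\<in>I. star (t i) * star (y i) * t i)"
    by (subst x) (simp add: star_sum star_simps mult.assoc)
  have pd: "pos (star (d i) * d i)" for i by (rule pos_star_mult_self)
  have pg: "pos (g i)" if "i \<in> I" for i
    unfolding g_def using y[OF that] by (intro pos_conj) (simp flip: norm_le_one_iff_pos)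
  have "star (d i) * d i + g i = star (t i) * t i + star x * (star (t i) * t i) * x
      - star (t i) * star (y i) * t i * x - star x * (star (t i) * y i * t i)" for i
    by (simp add: d_def g_def star_simps algebra_simps)
  hence "(\<Sum>i\<in>I. star (d i) * d i + g i) = 1 + star x * 1 * x - star x * x - star x * x"
    by (simp add: sum.distrib sum_subtractf t1 flip: sum_distrib_left sum_distrib_right sx x)
  hence 0: "(\<Sum>i\<in>I. star (d i) * d i + g i) = 0" by (simp add: xx)
  have sum0: "star (d i) * d i + g i = 0"
    by (rule pos_sum_eq_0[OF fin _ 0 i]) (intro pos_add pd pg)
  have "pos (- (star (d i) * d i))"
    using pg[OF i] sum0 by (simp add: add_eq_0_iff)
  hence d0: "star (d i) * d i = 0" by (rule pos_uminus_eq_0[OF pd])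
  thus "y i * t i = t i * x" by (simp add: star_mult_self_eq_0 d_def)
  have "g i = 0" using sum0 d0 by simp
  \<comment> \<open>Conjugation by the right inverse \<open>s\<close> strips \<open>t i\<close> off
    \<open>g i\<close>.\<close>
  hence "star s * (star (t i) * (1 - star (y i) * y i) * t i) * s = 0" by (simp add: g_def)
  moreover have "star s * star (t i) = 1" using ts by (simp flip: star_mult)
  ultimately have "1 - star (y i) * y i = 0"
    by (simp add: mult.assoc ts mult_eq_assoc[OF \<open>star s * star (t i) = 1\<close>])
  thus "star (y i) * y i = 1" by simp
qed

section \<open>The central projection\<close>

text \<open>The parallelogram law makes a distance-minimising sequence in \<open>L\<close> Cauchy,
  and comparing its limit with nearby points of \<open>L\<close> forces orthogonality.\<close>

lemma orthogonal_projection_exists: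
  fixes L :: "'a::{real_inner, complete_space} set"
  assumes L: "subspace L" and cl: "closed L"
  shows "\<exists>p\<in>L. \<forall>l\<in>L. inner (x - p) l = 0"
proof -
  define J where "J l = (norm (x - l))\<^sup>2" for l
  define m where "m = Inf (J ` L)"
  have ne: "J ` L \<noteq> {}" using subspace_0[OF L] by auto
  have bdd: "bdd_below (J ` L)" by (auto simp: J_def intro!: bdd_belowI[of _ 0])
  have m_le: "m \<le> J l" if "l \<in> L" for l
    unfolding m_def using that by (intro cInf_lower[OF _ bdd]) simp
  have "\<exists>l\<in>L. J l < m + 1 / real (Suc n)" for n
  proof -
    have "Inf (J ` L) < m + 1 / real (Suc n)" by (simp add: m_def)
    thus ?thesis by (subst (asm) cInf_less_iff[OF ne bdd]) auto
  qed
  then obtain X where XL: "\<And>n. X n \<in> L" and X: "\<And>n. J (X n) < m + 1 / real (Suc n)" by metis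
  have par: "(norm (a - b))\<^sup>2 \<le> 2 * J a + 2 * J b - 4 * m" if "a \<in> L" "b \<in> L" for a b
  proof -
    have "(norm (a - b))\<^sup>2 = 2 * J a + 2 * J b - 4 * J ((1/2) *\<^sub>R (a + b))"
      unfolding J_def power2_norm_eq_inner
      by (simp add: inner_add_left inner_add_right inner_diff_left inner_diff_right inner_commute
          algebra_simps)
    moreover have "(1/2) *\<^sub>R (a + b) \<in> L" by (intro subspace_scale subspace_add L that)
    ultimately show ?thesis using m_le[of "(1/2) *\<^sub>R (a + b)"] by simp
  qed
  have "Cauchy X"
  proof (rule metric_CauchyI)
    fix e :: real assume "0 < e"
    then obtain N where N: "1 / real (Suc N) < e\<^sup>2 / 4"
      using reals_Archimedean[of "e\<^sup>2 / 4"] by (auto simp: inverse_eq_divide)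
    have "dist (X a) (X b) < e" if "a \<ge> N" "b \<ge> N" for a b
    proof -
      have "1 / real (Suc a) \<le> 1 / real (Suc N)" "1 / real (Suc b) \<le> 1 / real (Suc N)"
        using that by (auto intro!: divide_left_mono)
      hence "(norm (X a - X b))\<^sup>2 < e\<^sup>2"
        using par[OF XL XL, of a b] X[of a] X[of b] N by linarith
      thus ?thesis using \<open>0 < e\<close> by (simp add: dist_norm power2_less_imp_less)
    qed
    thus "\<exists>N. \<forall>a\<ge>N. \<forall>b\<ge>N. dist (X a) (X b) < e" by blast
  qed
  then obtain p where p: "X \<longlonglongrightarrow> p" using Cauchy_convergent convergentD by blast
  have pL: "p \<in> L" using closed_sequentially[OF cl] XL p by blast
  have "(\<lambda>n. J (X n)) \<longlonglongrightarrow> J p" unfolding J_def by (intro tendsto_intros p)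
  moreover have "(\<lambda>n. m + 1 / real (Suc n)) \<longlonglongrightarrow> m + 0"
    by (intro tendsto_intros LIMSEQ_Suc[OF lim_1_over_n])
  ultimately have "J p \<le> m + 0"
    by (rule LIMSEQ_le) (use X in \<open>auto intro: less_imp_le\<close>)
  hence Jp: "J p \<le> J l" if "l \<in> L" for l using m_le[OF that] by simp
  have "inner (x - p) l = 0" if l: "l \<in> L" for l
  proof (cases "l = 0")
    case False
    define c where "c = inner (x - p) l"
    \<comment> \<open>The minimiser of the quadratic in \<open>t\<close> that gives the squared
      distance along the line through \<open>p\<close> in direction \<open>l\<close>.\<close>
    define t where "t = c / (norm l)\<^sup>2"
    have n: "(norm l)\<^sup>2 > 0" using False by simp
    have "p + t *\<^sub>R l \<in> L" by (intro subspace_add subspace_scale L pL l)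
    moreover have "J (p + t *\<^sub>R l) = J p - 2 * t * c + t\<^sup>2 * (norm l)\<^sup>2"
      unfolding J_def c_def power2_norm_eq_inner
      by (simp add: inner_add_left inner_add_right inner_diff_left inner_diff_right inner_commute
          algebra_simps power2_eq_square)
    ultimately have "0 \<le> - 2 * t * c + t\<^sup>2 * (norm l)\<^sup>2" using Jp by force
    also have "\<dots> = - (c\<^sup>2 / (norm l)\<^sup>2)"
      using n by (simp add: t_def power2_eq_square field_simps)
    finally have "c\<^sup>2 / (norm l)\<^sup>2 \<le> 0" by simp
    hence "c\<^sup>2 \<le> 0" using n by (simp add: divide_le_0_iff)
    thus ?thesis by (simp add: c_def)
  qed simp
  thus ?thesis using pL by blast
qed

text \<open>Orthogonality determines the nearest point, and this uniqueness yields linearity.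
  Closure of \<open>L\<close> under complex scalars makes real orthogonality enough for complex
  linearity.\<close>

lemma cop_orthogonal_projection_exists:
  fixes L :: "'h::chilbert_space set"
  assumes L: "subspace L" and cl: "closed L" and sc: "\<And>c x. x \<in> L \<Longrightarrow> c *\<^sub>C x \<in> L"
  obtains P where "is_projection P" "\<And>x. cop_apply P x \<in> L" "\<And>x. x \<in> L \<Longrightarrow> cop_apply P x = x"
    "\<And>x l. l \<in> L \<Longrightarrow> inner (x - cop_apply P x) l = 0"
proof -
  obtain g where gL: "\<And>x. g x \<in> L" and g: "\<And>x l. l \<in> L \<Longrightarrow> inner (x - g x) l = 0"
    using orthogonal_projection_exists[OF L cl] by metis
  have unique: "g x = p" if "p \<in> L" "\<And>l. l \<in> L \<Longrightarrow> inner (x - p) l = 0" for x p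
  proof -
    have "g x - p \<in> L" by (intro subspace_diff L gL that)
    hence "inner (x - p) (g x - p) - inner (x - g x) (g x - p) = 0" using g that(2) by simp
    hence "inner (g x - p) (g x - p) = 0" by (simp flip: inner_diff_left)
    thus ?thesis by simp
  qed
  have inner_sc: "inner (c *\<^sub>C x) y = inner x (cnj c *\<^sub>C y)" for c and x y :: 'h
    by (simp add: cinner_scaleC_left cinner_scaleC_right flip: Re_cinner)
  have gsc: "g (c *\<^sub>C x) = c *\<^sub>C g x" for c x
    by (rule unique) (simp_all add: sc gL g inner_sc flip: scaleC_diff_right)
  have "bounded_linear g"
  proof (rule bounded_linear_intro[where K = 1])
    show "g (x + y) = g x + g y" for x y
    proof (rule unique)
      show "inner (x + y - (g x + g y)) l = 0" if "l \<in> L" for l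
        using g[OF that, of x] g[OF that, of y] by (simp add: inner_diff_left inner_add_left)
    qed (intro subspace_add L gL)
    show "g (r *\<^sub>R x) = r *\<^sub>R g x" for r x
      using gsc[of "complex_of_real r" x] by (simp add: scaleC_of_real)
    show "norm (g x) \<le> norm x * 1" for x
    proof -
      have "(norm (g x))\<^sup>2 = inner x (g x)"
        using g[OF gL[of x], of x] by (simp add: inner_diff_left power2_norm_eq_inner)
      also have "\<dots> \<le> norm x * norm (g x)" by (rule norm_cauchy_schwarz)
      finally show ?thesis by (cases "g x = 0") (simp_all add: power2_eq_square)
    qed
  qed
  then obtain P where P: "cop_apply P = g" using cop_exists[of g] gsc by blast
  have gid: "g x = x" if "x \<in> L" for x by (rule unique) (use that in simp_all)
  have "P * P = P" by (rule cop_eqI) (simp add: cop_apply_times P gid gL)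
  moreover have "star P = P"
  proof (rule cop_eqI_inner)
    fix x y
    have "inner (g x) y = inner (g x) (g y)"
      using g[OF gL[of x], of y] by (simp add: inner_diff_left inner_diff_right inner_commute)
    also have "\<dots> = inner x (g y)"
      using g[OF gL[of y], of x] by (simp add: inner_diff_left)
    finally show "inner x (cop_apply (star P) y) = inner x (cop_apply P y)"
      by (simp add: P flip: inner_star)
  qed
  ultimately show ?thesis using that[of P] gL g gid by (simp add: P is_projection_def)
qed

text \<open>The kernels of \<open>(1 - x x\<^sup>*) a\<close>, \<open>a \<in> M\<close>, meet in a subspace that is invariant under \<open>M\<close>
  and its commutant; the complement of the projection onto it is the required \<open>z\<close>.\<close>

lemma full_partial_isometry_central_projection:
  fixes x :: "'h::chilbert_space cop"
  assumes M: "von_neumann_algebra M" and x: "full_partial_isometry x M"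
  obtains z where "z \<in> M" "is_projection z" "\<And>a. a \<in> M \<Longrightarrow> a * z = z * a"
    "(1 - star x * x) * z = 0" "(1 - x * star x) * (1 - z) = 0"
proof -
  note A = von_neumann_subalgebra[OF M]
  define q where "q = 1 - x * star x"
  define p where "p = 1 - star x * x"
  have xM: "x \<in> M" and qap: "\<And>a. a \<in> M \<Longrightarrow> q * a * p = 0"
    using x by (simp_all add: full_partial_isometry_def q_def p_def)
  have qM: "q \<in> M" unfolding q_def by (intro subalgebra_intros A xM)
  define L where "L = {\<xi>. \<forall>a\<in>M. cop_apply (q * a) \<xi> = 0}"
  note lin = bounded_linear_cop_apply[THEN linear_simps(1)] bounded_linear_cop_apply[THEN linear_simps(5)]
    bounded_linear_cop_apply[THEN linear_simps(3)]
  have "subspace L" unfolding L_def by (auto simp: subspace_def lin)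
  moreover have "closed L"
  proof -
    have "L = (\<Inter>a\<in>M. {\<xi>. cop_apply (q * a) \<xi> = 0})" by (auto simp: L_def)
    moreover have "closed {\<xi>. cop_apply (q * a) \<xi> = 0}" for a
      by (intro closed_Collect_eq continuous_on_const
          bounded_linear.continuous_on[OF bounded_linear_cop_apply] continuous_on_id)
    ultimately show ?thesis by (auto intro: closed_INT)
  qed
  moreover have "c *\<^sub>C \<xi> \<in> L" if "\<xi> \<in> L" for c \<xi> using that by (simp add: L_def cop_apply_scaleC)
  ultimately obtain P where P: "is_projection P" "\<And>\<xi>. cop_apply P \<xi> \<in> L"
    "\<And>\<xi>. \<xi> \<in> L \<Longrightarrow> cop_apply P \<xi> = \<xi>" "\<And>\<xi> l. l \<in> L \<Longrightarrow> inner (\<xi> - cop_apply P \<xi>) l = 0"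
    using cop_orthogonal_projection_exists by metis
  have PbP: "P * b * P = b * P" if "\<And>\<xi>. \<xi> \<in> L \<Longrightarrow> cop_apply b \<xi> \<in> L" for b
    by (rule cop_eqI) (simp add: cop_apply_times P that)
  \<comment> \<open>Invariance of \<open>L\<close> under \<open>b\<close> gives PbP = bP; invariance
    under the adjoint gives PbP = Pb.\<close>
  have commute: "b * P = P * b"
    if "\<And>\<xi>. \<xi> \<in> L \<Longrightarrow> cop_apply b \<xi> \<in> L" "\<And>\<xi>. \<xi> \<in> L \<Longrightarrow> cop_apply (star b) \<xi> \<in> L" for b
  proof -
    have sP: "star P = P" using P(1) by (simp add: is_projection_def)
    have "P * b * P = P * b"
      using arg_cong[OF PbP[of "star b"], of star] that(2) by (simp add: star_simps sP mult.assoc)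
    thus ?thesis using PbP[of b] that(1) by simp
  qed
  have inv: "cop_apply b \<xi> \<in> L" if b: "b \<in> M" and "\<xi> \<in> L" for b \<xi>
  proof -
    have "cop_apply (q * a) (cop_apply b \<xi>) = cop_apply (q * (a * b)) \<xi>" for a
      by (simp add: cop_apply_times)
    thus ?thesis using that subalgebra_mult[OF A] by (simp add: L_def)
  qed
  have inv': "cop_apply b \<xi> \<in> L" if b: "b \<in> commutant M" and "\<xi> \<in> L" for b \<xi>
  proof -
    have "cop_apply (q * a) (cop_apply b \<xi>) = cop_apply b (cop_apply (q * a) \<xi>)" if "a \<in> M" for a
      using commutantD[OF b subalgebra_mult[OF A qM that]] by (simp flip: cop_apply_times)
    thus ?thesis using that by (simp add: L_def lin)
  qed
  \<comment> \<open>Invariance under the commutant puts \<open>P\<close> into the bicommutant;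
    invariance under \<open>M\<close> makes it central.\<close>
  have PM: "P \<in> M"
    by (rule von_neumann_memI[OF M]) (metis commute inv' commutant_star[OF A])
  have PMc: "a * P = P * a" if "a \<in> M" for a
    using commute[of a] inv that subalgebra_star[OF A that] by blast
  have "q * P = 0"
  proof (rule cop_eqI)
    fix \<xi>
    have "cop_apply (q * 1) (cop_apply P \<xi>) = 0"
      using P(2)[of \<xi>] subalgebra_one[OF A] unfolding L_def by blast
    thus "cop_apply (q * P) \<xi> = cop_apply 0 \<xi>" by (simp add: cop_apply_times cop_apply_simps)
  qed
  moreover have "P * p = p"
  proof (rule cop_eqI)
    fix \<xi>
    have "cop_apply (q * a) (cop_apply p \<xi>) = 0" if "a \<in> M" for a
      using qap[OF that] by (simp add: cop_apply_simps flip: cop_apply_times)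
    hence "cop_apply p \<xi> \<in> L" by (simp add: L_def)
    thus "cop_apply (P * p) \<xi> = cop_apply p \<xi>" by (simp add: cop_apply_times P(3))
  qed
  moreover have "p * P = P * p"
    unfolding p_def by (rule PMc) (intro subalgebra_intros A xM)
  ultimately show ?thesis
    using PM PMc P(1)
    by (intro that[of "1 - P"] subalgebra_intros A is_projection_compl)
      (simp_all add: algebra_simps p_def[symmetric] q_def[symmetric])
qed

text \<open>On the part under \<open>z\<close> the element \<open>x\<close> is isometric. Replacing
  it and each \<open>y i\<close> by the identity on 1 - z yields a genuine isometry and preserves
  the combination, because the coefficients satisfy the normalisation \<open>t1\<close>.\<close>

lemma cstar_combination_isometric_corner:
  fixes x :: "'h::chilbert_space cop" and t y :: "'i \<Rightarrow> 'h cop"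
  assumes M: "von_neumann_algebra M" and xM: "x \<in> M"
    and z: "z \<in> M" "is_projection z" "\<And>a. a \<in> M \<Longrightarrow> a * z = z * a" and xz: "(1 - star x * x) * z = 0"
    and fin: "finite I" and t1: "(\<Sum>i\<in>I. star (t i) * t i) = 1"
    and x: "x = (\<Sum>i\<in>I. star (t i) * y i * t i)"
    and y: "\<And>i. i \<in> I \<Longrightarrow> y i \<in> unit_ball M" and t: "\<And>i. i \<in> I \<Longrightarrow> invertible_in M (t i)"
    and i: "i \<in> I"
  obtains u where "unitary_in M u" "y i * u * z = u * x * z"
proof -
  note A = von_neumann_subalgebra[OF M]
  have zz: "star z = z" "z * z = z" using z(2) by (simp_all add: is_projection_def)
  define ext where "ext a = a * z + (1 - z)" for a
  have ext: "star (ext a) * ext a = star a * a * z + (1 - z)" "ext a * z = a * z"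
    if "a \<in> M" for a
  proof -
    have az: "z * a = a * z" "z * star a = star a * z"
      using z(3)[OF that] z(3)[OF subalgebra_star[OF A that]] by simp_all
    have "star (ext a) = star a * z + (1 - z)" "ext a = z * a + (1 - z)"
      by (simp_all add: ext_def star_simps zz az)
    hence "star (ext a) * ext a = (star a * z + (1 - z)) * (z * a + (1 - z))" by simp
    also have "\<dots> = star a * (z * a) + (1 - z)"
      by (simp add: algebra_simps zz mult_eq_assoc[OF zz(2)])
    finally show "star (ext a) * ext a = star a * a * z + (1 - z)" by (simp add: az mult.assoc)
    show "ext a * z = a * z" by (simp add: ext_def algebra_simps zz)
  qed
  have extM: "ext a \<in> M" if "a \<in> M" for a unfolding ext_def by (intro subalgebra_intros A z that)
  have yM: "y j \<in> M" "norm (y j) \<le> 1" if "j \<in> I" for j using y[OF that] by (simp_all add: unit_ball_iff)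
  obtain s where ts: "t i \<in> M" "s \<in> M" "t i * s = 1" "s * t i = 1"
    using t[OF i] by (auto simp: invertible_in_def)
  have xx: "star (ext x) * ext x = 1" using xz by (simp add: ext(1)[OF xM] algebra_simps)
  have "ext x = (\<Sum>j\<in>I. star (t j) * y j * t j) * z + (\<Sum>j\<in>I. star (t j) * t j) * (1 - z)"
    by (simp add: ext_def t1 flip: x)
  also have "\<dots> = (\<Sum>j\<in>I. star (t j) * ext (y j) * t j)"
    unfolding sum_distrib_right sum.distrib[symmetric]
  proof (rule sum.cong[OF refl])
    fix j assume "j \<in> I"
    hence "t j * z = z * t j" using t z(3) by (auto simp: invertible_in_def)
    thus "star (t j) * y j * t j * z + star (t j) * t j * (1 - z) = star (t j) * ext (y j) * t j"
      by (simp add: ext_def algebra_simps)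
  qed
  finally have x': "ext x = (\<Sum>j\<in>I. star (t j) * ext (y j) * t j)" .
  have n: "norm (ext (y j)) \<le> 1" if "j \<in> I" for j
  proof -
    have "pos (star z * (1 - star (y j) * y j) * z)"
      using yM(2)[OF that] by (intro pos_conj) (simp flip: norm_le_one_iff_pos)
    also have "star z * (1 - star (y j) * y j) * z = z - z * (star (y j) * y j) * z"
      by (simp add: zz algebra_simps)
    also have "z * (star (y j) * y j) = star (y j) * y j * z"
      by (rule z(3)[symmetric]) (intro subalgebra_intros A yM that)
    also have "z - star (y j) * y j * z * z = 1 - star (ext (y j)) * ext (y j)"
      by (simp add: ext(1)[OF yM(1)[OF that]] zz mult.assoc)
    finally show ?thesis by (simp only: norm_le_one_iff_pos)
  qed
  have yt: "ext (y i) * t i = t i * ext x" and yy: "star (ext (y i)) * ext (y i) = 1"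
    using isometry_as_cstar_convex_combination[where y = "\<lambda>j. ext (y j)", OF fin xx t1 x' n i ts(3)]
    by simp_all
  obtain u where u: "unitary_in M u" "ext (y i) * u = u * ext x"
    using similar_isometries_unitarily_equivalent[OF M extM[OF xM] extM[OF yM(1)[OF i]] ts(1,2) xx yy
        ts(3,4) yt] by metis
  have uz: "u * z = z * u" using u(1) z(3) by (simp add: unitary_in_def)
  have "y i * u * z = (ext (y i) * z) * u" by (simp add: ext(2)[OF yM(1)[OF i]] mult.assoc uz)
  also have "\<dots> = (ext (y i) * u) * z" by (simp add: mult.assoc uz)
  also have "\<dots> = u * x * z" by (simp add: u(2) mult.assoc ext(2)[OF xM])
  finally show ?thesis using that u(1) by blast
qed

text \<open>\<open>x\<close> is isometric under \<open>z\<close>, and \<open>star x\<close> is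
  isometric under 1 - z. The corner lemma applies to each, and centrality of \<open>z\<close> allows
  the two unitaries to be glued.\<close>

lemma cstar_extreme_of_full_partial_isometry:
  fixes x :: "'h::chilbert_space cop"
  assumes M: "von_neumann_algebra M" and x: "full_partial_isometry x M"
  shows "cstar_extreme_point_of_ball x M"
proof -
  note A = von_neumann_subalgebra[OF M]
  have xM: "x \<in> M" and nx: "norm x \<le> 1"
    using x norm_partial_isometry_le by (auto simp: full_partial_isometry_def)
  obtain z where z: "z \<in> M" "is_projection z" "\<And>a. a \<in> M \<Longrightarrow> a * z = z * a"
    "(1 - star x * x) * z = 0" "(1 - x * star x) * (1 - z) = 0"
    using full_partial_isometry_central_projection[OF M x] by metis
  define z' where "z' = 1 - z"
  have z': "z' \<in> M" "is_projection z'" "\<And>a. a \<in> M \<Longrightarrow> a * z' = z' * a"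
    "(1 - star (star x) * star x) * z' = 0"
    using z by (auto simp: z'_def is_projection_compl star_star algebra_simps intro!: subalgebra_intros A)
  have zz: "star z = z" "z * z = z" "star z' = z'" "z' * z' = z'" "z * z' = 0" "z' * z = 0" "z + z' = 1"
    using z(2) by (simp_all add: is_projection_def z'_def algebra_simps star_simps)
  have "\<exists>u. unitary_in M u \<and> y i = star u * x * u"
    if y: "\<And>i. i \<in> {1..k} \<Longrightarrow> y i \<in> unit_ball M" and t: "\<And>i. i \<in> {1..k} \<Longrightarrow> invertible_in M (t i)"
      and t1: "(\<Sum>i = 1..k. star (t i) * t i) = 1" and xs: "x = (\<Sum>i = 1..k. star (t i) * y i * t i)"
      and i: "i \<in> {1..k}" for k :: nat and y t i
  proof -
    have yM: "y i \<in> M" using y[OF i] by (simp add: unit_ball_iff)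
    obtain u where u: "unitary_in M u" "y i * u * z = u * x * z"
      using cstar_combination_isometric_corner[OF M xM z(1-4) finite_atLeastAtMost t1 xs y t i] by metis
    have xs': "star x = (\<Sum>i = 1..k. star (t i) * star (y i) * t i)"
      by (subst xs) (simp add: star_sum star_simps mult.assoc)
    have y': "star (y i) \<in> unit_ball M" if "i \<in> {1..k}" for i
      using y[OF that] subalgebra_star[OF A] by (simp add: unit_ball_iff)
    obtain v where v: "unitary_in M v" "star (y i) * v * z' = v * star x * z'"
      using cstar_combination_isometric_corner[where y = "\<lambda>i. star (y i)",
          OF M subalgebra_star[OF A xM] z' finite_atLeastAtMost t1 xs' y' t i] by metis
    have uM: "u \<in> M" "star u \<in> M" "star u * u = 1" "u * star u = 1"
      and vM: "v \<in> M" "star v \<in> M" "star v * v = 1" "v * star v = 1"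
      using u(1) v(1) subalgebra_star[OF A] by (simp_all add: unitary_in_def)
    \<comment> \<open>The corner lemma gave an intertwining of adjoints; multiplying by
      \<open>star v\<close> on both sides and taking adjoints turns it into one for
      \<open>y i\<close> and \<open>x\<close>.\<close>
    have "star v * star (y i) * z' = star v * star (y i) * (v * star v) * z'" by (simp add: vM)
    also have "\<dots> = star v * (star (y i) * v * z') * star v"
      by (simp only: mult.assoc z'(3)[OF vM(2)])
    also have "\<dots> = (star v * v) * star x * (z' * star v)" unfolding v(2) by (simp only: mult.assoc)
    also have "\<dots> = star x * star v * z'" by (simp add: vM mult.assoc z'(3)[OF vM(2)])
    finally have "star v * star (y i) * z' = star x * star v * z'" .
    from arg_cong[OF this, of star] have "z' * (y i * v) = z' * (v * x)"
      by (simp add: star_simps zz)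
    hence vz: "y i * v * z' = v * x * z'"
      using z'(3)[OF subalgebra_mult[OF A yM vM(1)]] z'(3)[OF subalgebra_mult[OF A vM(1) xM]] by simp
    define w where "w = u * z + v * z'"
    have wx: "y i * w = w * x"
      using u(2) vz z(3)[OF xM] z'(3)[OF xM] by (simp add: w_def algebra_simps)
    have wM: "w \<in> M" unfolding w_def by (intro subalgebra_intros A uM vM z z')
    have sw: "star w = star u * z + star v * z'"
      using z(3)[OF uM(2)] z'(3)[OF vM(2)] by (simp add: w_def star_simps zz)
    have prod: "(a * z + b * z') * (c * z + d * z') = a * c * z + b * d * z'"
      if "a \<in> M" "b \<in> M" "c \<in> M" "d \<in> M" for a b c d
    proof -
      have "(a * z + b * z') * (c * z + d * z')
          = a * (z * c) * z + a * (z * d) * z' + b * (z' * c) * z + b * (z' * d) * z'"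
        by (simp add: algebra_simps)
      also have "\<dots> = a * c * (z * z) + a * d * (z * z') + b * c * (z' * z) + b * d * (z' * z')"
        unfolding z(3)[OF that(3), symmetric] z(3)[OF that(4), symmetric]
          z'(3)[OF that(3), symmetric] z'(3)[OF that(4), symmetric] by (simp only: mult.assoc)
      finally show ?thesis by (simp add: zz)
    qed
    have "star w * w = 1" "w * star w = 1"
      unfolding sw unfolding w_def by (simp_all add: prod uM vM zz)
    \<comment> \<open>The definition asks for y = u*xu, so the witness is the adjoint of
      \<open>w\<close>.\<close>
    hence "unitary_in M (star w)" "y i = star (star w) * x * star w"
      using wM subalgebra_star[OF A wM] arg_cong[OF wx, of "\<lambda>a. a * star w"]
      by (simp_all add: unitary_in_def star_star mult.assoc)
    thus ?thesis by blast
  qed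
  hence "\<exists>u. \<forall>i\<in>{1..k}. unitary_in M (u i) \<and> y i = star (u i) * x * u i"
    if "(\<forall>i\<in>{1..k}. y i \<in> unit_ball M \<and> invertible_in M (t i)) \<and>
        (\<Sum>i = 1..k. star (t i) * t i) = 1 \<and> x = (\<Sum>i = 1..k. star (t i) * y i * t i)"
    for k :: nat and y t
    using that by (intro bchoice ballI) blast
  thus ?thesis using xM nx unfolding cstar_extreme_point_of_ball_def unit_ball_iff by blast
qed

theorem theorem2:
  shows "(\<forall>(M :: 'h::chilbert_space cop set) x.
            von_neumann_algebra M \<and> x \<in> unit_ball M \<longrightarrow>
              (cstar_extreme_point_of_ball x M \<longleftrightarrow> x extreme_point_of unit_ball M) \<and>
              (x extreme_point_of unit_ball M \<longleftrightarrow> x strongly_extreme_point_of unit_ball M)) \<and>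
         (\<forall>a :: 'a::unital_cstar_algebra.
            a extreme_point_of unit_ball UNIV \<longrightarrow> a strongly_extreme_point_of unit_ball UNIV)"
proof (intro conjI allI impI)
  fix M :: "'h cop set" and x
  assume "von_neumann_algebra M \<and> x \<in> unit_ball M"
  hence M: "von_neumann_algebra M" and A: "unital_star_subalgebra M"
    by (simp_all add: von_neumann_subalgebra)
  \<comment> \<open>A cycle: extreme implies full partial isometry, which implies strongly extreme,
    which implies extreme.\<close>
  show ext: "x extreme_point_of unit_ball M \<longleftrightarrow> x strongly_extreme_point_of unit_ball M"
    using full_partial_isometry_of_extreme_point[OF A] strongly_extreme_of_full_partial_isometry[OF A]
      extreme_point_of_strongly_extreme[OF convex_unit_ball[OF A]] by blast
  show "cstar_extreme_point_of_ball x M \<longleftrightarrow> x extreme_point_of unit_ball M"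
    using full_partial_isometry_of_extreme_point[OF A] cstar_extreme_of_full_partial_isometry[OF M]
      full_partial_isometry_of_cstar_extreme[OF M] strongly_extreme_of_full_partial_isometry[OF A] ext
    by blast
next
  fix a :: 'a
  assume "a extreme_point_of unit_ball UNIV"
  thus "a strongly_extreme_point_of unit_ball UNIV"
    using full_partial_isometry_of_extreme_point[OF subalgebra_UNIV]
      strongly_extreme_of_full_partial_isometry[OF subalgebra_UNIV] by blast
qed

end
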